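(* For all integers $k>\ell\ge1$ there exists $\phi\in\mathrm{Hom}^+(\mathcal A[T_{k\text{-Hypergraph}}],\mathbb R)$ satisfying $\mathrm{Independence}[\ell]$ but not satisfying $\mathrm{Disc}[\{[\ell+1]\}]$.
   Context: All languages are finite relational. A canonical theory over $\mathcal L$ is a universal theory containing, for each $P\in\mathcal L$, the axiom that $P(x_1,\dots,x_{k(P)})$ fails whenever two $x_i$ coincide; $T_{\mathcal L}$ is the canonical theory with only these axioms. $T_{k\text{-Hypergraph}}$: single $k$-ary predicate $E$ with symmetry axioms; $\rho_k$ is the $k$-vertex hypergraph with one edge. $T\cup T'$: disjoint union. $\mathcal M[T]$: isomorphism classes of finite models. $\mathrm{Hom}^+(\mathcal A[T],\mathbb R)$: functions $\phi:\mathcal M[T]\to[0,1]$, $\phi(M)=\lim_n p(M,N_n)$ for finite models $N_n$ of $T$ of strictly increasing size ($p(M,N)$ = probability a random $|M|$-subset of $V(N)$ induces a copy of $M$). Theons: for an atomless complete probability space $\Omega=(X,\mathcal A,\mu)$, $\mathcal E_V(\Omega)=X^{r(V)}$ with $r(V)$ the finite nonempty subsets of $V$, $\mathcal E_{m,\ell}(\Omega)=X^{\{A\in r([m]):|A|\le\ell\}}$, $\alpha^*(x)_A=x_{\alpha(A)}$. A $T$-on is a family of measurable $\mathcal N_P\subseteq\mathcal E_{[k(P)]}(\Omega)$ such that for random $\theta\in\mathcal E_{\mathbb N_+}(\Omega)$ the structure $\mathbf K$ on $\mathbb N_+$ with $R_P(\mathbf K)=\{\alpha\text{ injective}:\alpha^*(\theta)\in\mathcal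 N_P\}$ (the exchangeable array) is a.s. a model of $T$; $\phi_{\mathcal N}(M)=\Pr[\mathbf K|_{[|M|]}\cong M]$; every $\phi$ is of this form, and the law of $\mathbf K$ depends only on $\phi_{\mathcal N}$. A peon $\mathcal N_P\subseteq\mathcal E_{[m]}(\Omega)$ is $\ell$-independent if $\mathcal N_P=\mathcal E_{m,\ell}(\Omega)\times\mathcal H$ for some $\mathcal H\subseteq X^{\{A\subseteq[m]:|A|>\ell\}}$; $\phi$ satisfies $\mathrm{Independence}[\ell]$ if it is represented by a $T$-on all of whose peons are $\ell$-independent. Coupling of $\phi$ (theory $T$) and $\psi$ (theory $T'$): $\xi$ on $T\cup T'$ whose reducts to $T,T'$ are $\phi,\psi$. $\mathrm{Disc}[\mathcal A]$ for an antichain $\mathcal A$ of nonempty subsets of $[k]$: let $\mathcal L_{\mathcal A}$ have a predicate $P_A$ of arity $|A|$ for each $A\in\mathcal A$, $\iota_A$ the increasing enumeration of $A$. $\phi$ satisfies $\mathrm{Disc}[\mathcal A]$ if for every $\psi\in\mathrm{Hom}^+(\mathcal A[T_{\mathcal L_{\mathcal A}}],\mathbb R)$ and every coupling $\xi$ of $\phi$ and $\psi$, with $\mathbf K$ the exchangeable array of $\xi$, $\Pr[(1,\dots,k)\in R_E(\mathbf K)\wedge\forall A\in\mathcal A,\ \iota_A\in R_{P_A}(\mathbf K)]=\phi(\rho_k)\Pr[\forall A\in\mathcal A,\ \iota_A\in R_{P_A}(\mathbf K)]$. *)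

theory Defs
  imports "HOL-Probability.Probability"
begin

section \<open>Finite relational languages, universal theories, models\<close>

text \<open>
  Argument tuples of a predicate \<open>P\<close> of arity \<open>m\<close> are functions on \<open>[m] = {1..m}\<close>.
  A universal sentence is given by its quantifier-free matrix; all variables (natural numbers)
  are implicitly universally quantified.
\<close>

datatype 'p qf =
    Eq nat nat
  | Atom 'p "nat \<Rightarrow> nat"
  | Neg "'p qf"
  | Conj "'p qf" "'p qf"

abbreviation Imp :: "'p qf \<Rightarrow> 'p qf \<Rightarrow> 'p qf" where
  "Imp f g \<equiv> Neg (Conj f (Neg g))"

record 'p utheory =
  symbols :: "'p set"
  arity :: "'p \<Rightarrow> nat"
  axs :: "'p qf set"

record 'p struct =
  verts :: "nat set"
  rel :: "'p \<Rightarrow> (nat \<Rightarrow> nat) set"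

definition is_struct :: "'p utheory \<Rightarrow> 'p struct \<Rightarrow> bool" where
  "is_struct T M \<longleftrightarrow>
     (\<forall>P \<in> symbols T. rel M P \<subseteq> ({1..arity T P} \<rightarrow>\<^sub>E verts M)) \<and>
     (\<forall>P. P \<notin> symbols T \<longrightarrow> rel M P = {})"

primrec holds :: "'p utheory \<Rightarrow> 'p struct \<Rightarrow> (nat \<Rightarrow> nat) \<Rightarrow> 'p qf \<Rightarrow> bool" where
  "holds T M v (Eq i j) \<longleftrightarrow> v i = v j"
| "holds T M v (Atom P x) \<longleftrightarrow> (\<lambda>i\<in>{1..arity T P}. v (x i)) \<in> rel M P"
| "holds T M v (Neg f) \<longleftrightarrow> \<not> holds T M v f"
| "holds T M v (Conj f g) \<longleftrightarrow> holds T M v f \<and> holds T M v g"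

definition is_model :: "'p utheory \<Rightarrow> 'p struct \<Rightarrow> bool" where
  "is_model T M \<longleftrightarrow>
     is_struct T M \<and> (\<forall>f \<in> axs T. \<forall>v. range v \<subseteq> verts M \<longrightarrow> holds T M v f)"

definition fin_models :: "'p utheory \<Rightarrow> 'p struct set" where
  "fin_models T = {M. is_model T M \<and> finite (verts M)}"

definition canonical_axs :: "'p set \<Rightarrow> ('p \<Rightarrow> nat) \<Rightarrow> 'p qf set" where
  "canonical_axs L ar =
     {Imp (Eq i j) (Neg (Atom P id)) |P i j. P \<in> L \<and> 1 \<le> i \<and> i < j \<and> j \<le> ar P}"

definition pure_theory :: "'p set \<Rightarrow> ('p \<Rightarrow> nat) \<Rightarrow> 'p utheory" where
  "pure_theory L ar = \<lparr>symbols = L, arity = ar, axs = canonical_axs L ar\<rparr>"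

definition hypergraph_theory :: "nat \<Rightarrow> unit utheory" where
  "hypergraph_theory k =
     \<lparr>symbols = {()}, arity = (\<lambda>_. k),
      axs = canonical_axs {()} (\<lambda>_. k) \<union>
            {Imp (Atom () id) (Atom () s) |s. s permutes {1..k}}\<rparr>"

definition union_theory :: "'p utheory \<Rightarrow> 'q utheory \<Rightarrow> ('p + 'q) utheory" where
  "union_theory T T' =
     \<lparr>symbols = symbols T <+> symbols T', arity = case_sum (arity T) (arity T'),
      axs = map_qf Inl ` axs T \<union> map_qf Inr ` axs T'\<rparr>"


section \<open>Isomorphism classes, densities and limits\<close>

definition iso :: "'p utheory \<Rightarrow> 'p struct \<Rightarrow> 'p struct \<Rightarrow> bool" where
  "iso T M N \<longleftrightarrow>
     (\<exists>f. bij_betw f (verts M) (verts N) \<and>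
        (\<forall>P \<in> symbols T. \<forall>\<alpha> \<in> {1..arity T P} \<rightarrow>\<^sub>E verts M.
           \<alpha> \<in> rel M P \<longleftrightarrow> (\<lambda>i\<in>{1..arity T P}. f (\<alpha> i)) \<in> rel N P))"

definition iso_class :: "'p utheory \<Rightarrow> 'p struct \<Rightarrow> 'p struct set" where
  "iso_class T M = {N \<in> fin_models T. iso T M N}"

definition model_classes :: "'p utheory \<Rightarrow> 'p struct set set" where
  "model_classes T = iso_class T ` fin_models T"

definition induced :: "'p utheory \<Rightarrow> 'p struct \<Rightarrow> nat set \<Rightarrow> 'p struct" where
  "induced T M W =
     \<lparr>verts = W, rel = (\<lambda>P. {\<alpha> \<in> rel M P. \<alpha> ` {1..arity T P} \<subseteq> W})\<rparr>"

definition density :: "'p utheory \<Rightarrow> 'p struct \<Rightarrow> 'p struct \<Rightarrow> real" where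
  "density T M N =
     real (card {W. W \<subseteq> verts N \<and> card W = card (verts M) \<and> iso T (induced T N W) M}) /
     real (card (verts N) choose card (verts M))"

definition Hom_plus :: "'p utheory \<Rightarrow> ('p struct set \<Rightarrow> real) set" where
  "Hom_plus T =
     {\<phi> \<in> model_classes T \<rightarrow>\<^sub>E {0..1}.
        \<exists>N :: nat \<Rightarrow> 'p struct.
          (\<forall>n. N n \<in> fin_models T) \<and> strict_mono (\<lambda>n. card (verts (N n))) \<and>
          (\<forall>M \<in> fin_models T. (\<lambda>n. density T M (N n)) \<longlonglongrightarrow> \<phi> (iso_class T M))}"

text \<open>
  \<open>c\<close> embeds the symbols of \<open>T\<close> into those of \<open>U\<close>. The reduct of a limit assigns to a class
  the total weight of the classes of \<open>U\<close>-models whose reduct lies in it.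
\<close>

definition reduct :: "('p \<Rightarrow> 'q) \<Rightarrow> 'q struct \<Rightarrow> 'p struct" where
  "reduct c M = \<lparr>verts = verts M, rel = (\<lambda>P. rel M (c P))\<rparr>"

definition limit_reduct ::
  "('p \<Rightarrow> 'q) \<Rightarrow> 'p utheory \<Rightarrow> 'q utheory \<Rightarrow> ('q struct set \<Rightarrow> real) \<Rightarrow> 'p struct set \<Rightarrow> real"
where
  "limit_reduct c T U \<xi> =
     (\<lambda>C \<in> model_classes T. \<Sum>D \<in> {D \<in> model_classes U. \<exists>N \<in> D. reduct c N \<in> C}. \<xi> D)"

definition coupling ::
  "'p utheory \<Rightarrow> 'q utheory \<Rightarrow> ('p struct set \<Rightarrow> real) \<Rightarrow> ('q struct set \<Rightarrow> real) \<Rightarrow>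
   (('p + 'q) struct set \<Rightarrow> real) \<Rightarrow> bool"
where
  "coupling T T' \<phi> \<psi> \<xi> \<longleftrightarrow>
     \<xi> \<in> Hom_plus (union_theory T T') \<and>
     limit_reduct Inl T (union_theory T T') \<xi> = \<phi> \<and>
     limit_reduct Inr T' (union_theory T T') \<xi> = \<psi>"


section \<open>Theons\<close>

definition atomless :: "'x measure \<Rightarrow> bool" where
  "atomless \<Omega> \<longleftrightarrow>
     (\<forall>A \<in> sets \<Omega>. 0 < emeasure \<Omega> A \<longrightarrow>
        (\<exists>B \<in> sets \<Omega>. B \<subseteq> A \<and> 0 < emeasure \<Omega> B \<and> emeasure \<Omega> B < emeasure \<Omega> A))"

definition base_space :: "'x measure \<Rightarrow> bool" where
  "base_space \<Omega> \<longleftrightarrow> prob_space \<Omega> \<and> complete_measure \<Omega> \<and> atomless \<Omega>"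

definition fin_subsets :: "nat set \<Rightarrow> nat set set" where
  "fin_subsets V = {A. A \<subseteq> V \<and> finite A \<and> A \<noteq> {}}"

text \<open>The space \<open>\<E>\<^sub>V(\<Omega>)\<close>, with the completion of the product measure.\<close>

definition coord_space :: "'x measure \<Rightarrow> nat set \<Rightarrow> (nat set \<Rightarrow> 'x) measure" where
  "coord_space \<Omega> V = completion (PiM (fin_subsets V) (\<lambda>_. \<Omega>))"

definition pullback :: "nat \<Rightarrow> (nat \<Rightarrow> nat) \<Rightarrow> (nat set \<Rightarrow> 'x) \<Rightarrow> nat set \<Rightarrow> 'x" where
  "pullback m \<alpha> x = (\<lambda>A \<in> fin_subsets {1..m}. x (\<alpha> ` A))"

definition exch_array ::
  "'p utheory \<Rightarrow> ('p \<Rightarrow> (nat set \<Rightarrow> 'x) set) \<Rightarrow> (nat set \<Rightarrow> 'x) \<Rightarrow> 'p struct"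
where
  "exch_array T \<N> \<theta> =
     \<lparr>verts = {1..},
      rel = (\<lambda>P. if P \<in> symbols T
                 then {\<alpha> \<in> {1..arity T P} \<rightarrow>\<^sub>E {1..}.
                        inj_on \<alpha> {1..arity T P} \<and> pullback (arity T P) \<alpha> \<theta> \<in> \<N> P}
                 else {})\<rparr>"

definition theon :: "'x measure \<Rightarrow> 'p utheory \<Rightarrow> ('p \<Rightarrow> (nat set \<Rightarrow> 'x) set) \<Rightarrow> bool" where
  "theon \<Omega> T \<N> \<longleftrightarrow>
     base_space \<Omega> \<and>
     (\<forall>P \<in> symbols T. \<N> P \<in> sets (coord_space \<Omega> {1..arity T P})) \<and>
     (AE \<theta> in coord_space \<Omega> {1..}. is_model T (exch_array T \<N> \<theta>))"

definition theon_limit ::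
  "'x measure \<Rightarrow> 'p utheory \<Rightarrow> ('p \<Rightarrow> (nat set \<Rightarrow> 'x) set) \<Rightarrow> ('p struct set \<Rightarrow> real) \<Rightarrow> bool"
where
  "theon_limit \<Omega> T \<N> \<phi> \<longleftrightarrow>
     (\<forall>M \<in> fin_models T.
        \<phi> (iso_class T M) =
        \<P>(\<theta> in coord_space \<Omega> {1..}.
             iso T (induced T (exch_array T \<N> \<theta>) {1..card (verts M)}) M))"

text \<open>
  \<open>S = \<E>\<^bsub>m,l\<^esub>(\<Omega>) \<times> H\<close>, where a point of the product is a function on all nonempty
  subsets of \<open>[m]\<close> whose restriction to the subsets of size greater than \<open>l\<close> lies in \<open>H\<close>.
\<close>

definition peon_independent :: "'x measure \<Rightarrow> nat \<Rightarrow> nat \<Rightarrow> (nat set \<Rightarrow> 'x) set \<Rightarrow> bool" where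
  "peon_independent \<Omega> m l S \<longleftrightarrow>
     (\<exists>H \<subseteq> {A \<in> fin_subsets {1..m}. l < card A} \<rightarrow>\<^sub>E space \<Omega>.
        S = {x \<in> fin_subsets {1..m} \<rightarrow>\<^sub>E space \<Omega>.
               restrict x {A \<in> fin_subsets {1..m}. l < card A} \<in> H})"

text \<open>
  HOL cannot quantify over the type of the points of \<open>\<Omega>\<close>; here and in the definition of
  \<open>disc\<close> the base spaces range over all atomless complete probability spaces whose points
  are reals.
\<close>

definition independence :: "'p utheory \<Rightarrow> nat \<Rightarrow> ('p struct set \<Rightarrow> real) \<Rightarrow> bool" where
  "independence T l \<phi> \<longleftrightarrow>
     (\<exists>(\<Omega> :: real measure) \<N>.
        theon \<Omega> T \<N> \<and> theon_limit \<Omega> T \<N> \<phi> \<and>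
        (\<forall>P \<in> symbols T. peon_independent \<Omega> (arity T P) l (\<N> P)))"


section \<open>The property Disc\<close>

definition edge_graph :: "nat \<Rightarrow> unit struct" where
  "edge_graph k =
     \<lparr>verts = {1..k}, rel = (\<lambda>_. {\<alpha> \<in> {1..k} \<rightarrow>\<^sub>E {1..k}. inj_on \<alpha> {1..k}})\<rparr>"

definition incr_enum :: "nat set \<Rightarrow> nat \<Rightarrow> nat" where
  "incr_enum A = (\<lambda>i\<in>{1..card A}. sorted_list_of_set A ! (i - 1))"

text \<open>
  \<open>\<A>\<close> is meant to be an antichain of nonempty subsets of \<open>{1..k}\<close>; the predicate symbol
  \<open>P\<^sub>A\<close> is \<open>A\<close> itself. The law of the exchangeable array of \<open>\<xi>\<close> does not depend on the
  theon representing \<open>\<xi>\<close>, so the definition refers to all of them.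
\<close>

definition disc :: "nat \<Rightarrow> nat set set \<Rightarrow> (unit struct set \<Rightarrow> real) \<Rightarrow> bool" where
  "disc k \<A> \<phi> \<longleftrightarrow>
     (let T = hypergraph_theory k; T' = pure_theory \<A> card; U = union_theory T T' in
      \<forall>\<psi> \<in> Hom_plus T'. \<forall>\<xi>. coupling T T' \<phi> \<psi> \<xi> \<longrightarrow>
        (\<forall>(\<Omega> :: real measure) \<N>. theon \<Omega> U \<N> \<and> theon_limit \<Omega> U \<N> \<xi> \<longrightarrow>
           \<P>(\<theta> in coord_space \<Omega> {1..}.
                (\<lambda>i\<in>{1..k}. i) \<in> rel (exch_array U \<N> \<theta>) (Inl ()) \<and>
                (\<forall>A \<in> \<A>. incr_enum A \<in> rel (exch_array U \<N> \<theta>) (Inr A)))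
           = \<phi> (iso_class T (edge_graph k)) *
             \<P>(\<theta> in coord_space \<Omega> {1..}.
                  \<forall>A \<in> \<A>. incr_enum A \<in> rel (exch_array U \<N> \<theta>) (Inr A))))"

end

theory Submission
  imports Defs
begin

text \<open>
  Let \<open>G\<close> be the random \<open>(l + 1)\<close>-uniform hypergraph with edge probability \<open>1/2\<close>, given by the
  coordinates of level \<open>l + 1\<close>, and let \<open>\<phi>\<close> be the limit of the \<open>k\<close>-hypergraph of \<open>k\<close>-cliques
  of \<open>G\<close>. It ignores all coordinates of level at most \<open>l\<close>. Couple it with \<open>G\<close> itself: an edge
  of \<open>\<phi>\<close> on \<open>1, ..., k\<close> forces \<open>{1..l + 1}\<close> to be an edge of \<open>G\<close>, so the probability of the
  conjunction is \<open>\<phi>(\<rho>\<^sub>k) > 0\<close> rather than \<open>\<phi>(\<rho>\<^sub>k)/2\<close>.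

  That such arrays have limits in \<open>Hom_plus\<close> is a second moment argument: samples of
  disjoint sets of vertices are independent, hence the density of a fixed model in the
  array restricted to \<open>{1..n}\<close> has variance \<open>O(1/n)\<close>.
\<close>

section \<open>Structures and isomorphisms\<close>

text \<open>Independence at level l only silences coordinates of level at most l, whereas the single
  predicate tested by \<open>disc\<close> has arity l + 1 and may read coordinates of level l + 1.
  The construction lives exactly in this gap: l + 1 is the lowest level still free, and l < k puts
  such a set inside every k-set.

  The obstacle is the form of \<open>Hom_plus\<close> and \<open>coupling\<close>. Exhibiting arrays
  is not enough: the clique hypergraph, \<open>G\<close> and their joint structure each need finite
  models along which all densities converge, and the two reducts of the joint limit must be equal to
  the other two limits as functions. One formula, \<open>clique_peon\<close>, serves all three
  theories, since it reads only the arity: arity l + 1 gives \<open>G\<close>, arity k gives its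
  cliques. All three arrays are functions of the same \<theta>, so the reducts agree pointwise and
  not merely in law.

  A clique condition depends on a set of vertices and not on its order, so the axioms hold for every
  \<theta>. The second moment argument can therefore pick a single good \<theta> without avoiding
  null sets.\<close>

lemma iso_refl: "iso T M M"
  unfolding iso_def
proof (intro exI[of _ id] conjI ballI)
  fix P \<alpha> assume "\<alpha> \<in> {1..arity T P} \<rightarrow>\<^sub>E verts M"
  then have "(\<lambda>i\<in>{1..arity T P}. id (\<alpha> i)) = \<alpha>"
    by (auto simp: fun_eq_iff restrict_def PiE_def extensional_def)
  then show "\<alpha> \<in> rel M P \<longleftrightarrow> (\<lambda>i\<in>{1..arity T P}. id (\<alpha> i)) \<in> rel M P"
    by simp
qed simp

lemma iso_sym:
  assumes "iso T M N" shows "iso T N M"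
proof -
  obtain f where f: "bij_betw f (verts M) (verts N)"
    and r: "\<And>P \<alpha>. P \<in> symbols T \<Longrightarrow> \<alpha> \<in> {1..arity T P} \<rightarrow>\<^sub>E verts M \<Longrightarrow>
       \<alpha> \<in> rel M P \<longleftrightarrow> (\<lambda>i\<in>{1..arity T P}. f (\<alpha> i)) \<in> rel N P"
    using assms unfolding iso_def by blast
  define g where "g = inv_into (verts M) f"
  have g: "bij_betw g (verts N) (verts M)"
    unfolding g_def using f by (rule bij_betw_inv_into)
  have fg: "f (g y) = y" if "y \<in> verts N" for y
    unfolding g_def using f that by (rule bij_betw_inv_into_right)
  show ?thesis
    unfolding iso_def
  proof (intro exI[of _ g] conjI ballI g)
    fix P \<beta> assume P: "P \<in> symbols T" and \<beta>: "\<beta> \<in> {1..arity T P} \<rightarrow>\<^sub>E verts N"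
    define \<alpha> where "\<alpha> = (\<lambda>i\<in>{1..arity T P}. g (\<beta> i))"
    have "\<alpha> \<in> {1..arity T P} \<rightarrow>\<^sub>E verts M"
      unfolding \<alpha>_def using \<beta> g by (auto simp: bij_betw_def)
    moreover have "(\<lambda>i\<in>{1..arity T P}. f (\<alpha> i)) = \<beta>"
      unfolding \<alpha>_def using \<beta> by (auto simp: fun_eq_iff PiE_def extensional_def fg Pi_def)
    ultimately show "\<beta> \<in> rel N P \<longleftrightarrow> (\<lambda>i\<in>{1..arity T P}. g (\<beta> i)) \<in> rel M P"
      using r[OF P, of \<alpha>] by (simp add: \<alpha>_def)
  qed
qed

lemma iso_trans:
  assumes "iso T M N" "iso T N L" shows "iso T M L"
proof -
  obtain f where f: "bij_betw f (verts M) (verts N)"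
    and rf: "\<And>P \<alpha>. P \<in> symbols T \<Longrightarrow> \<alpha> \<in> {1..arity T P} \<rightarrow>\<^sub>E verts M \<Longrightarrow>
       \<alpha> \<in> rel M P \<longleftrightarrow> (\<lambda>i\<in>{1..arity T P}. f (\<alpha> i)) \<in> rel N P"
    using assms(1) unfolding iso_def by blast
  obtain g where g: "bij_betw g (verts N) (verts L)"
    and rg: "\<And>P \<alpha>. P \<in> symbols T \<Longrightarrow> \<alpha> \<in> {1..arity T P} \<rightarrow>\<^sub>E verts N \<Longrightarrow>
       \<alpha> \<in> rel N P \<longleftrightarrow> (\<lambda>i\<in>{1..arity T P}. g (\<alpha> i)) \<in> rel L P"
    using assms(2) unfolding iso_def by blast
  show ?thesis
    unfolding iso_def
  proof (intro exI[of _ "g \<circ> f"] conjI ballI)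
    show "bij_betw (g \<circ> f) (verts M) (verts L)"
      using f g by (rule bij_betw_trans)
    fix P \<alpha> assume P: "P \<in> symbols T" and \<alpha>: "\<alpha> \<in> {1..arity T P} \<rightarrow>\<^sub>E verts M"
    define \<beta> where "\<beta> = (\<lambda>i\<in>{1..arity T P}. f (\<alpha> i))"
    have "\<beta> \<in> {1..arity T P} \<rightarrow>\<^sub>E verts N"
      unfolding \<beta>_def using \<alpha> f by (auto simp: bij_betw_def)
    moreover have "(\<lambda>i\<in>{1..arity T P}. g (\<beta> i)) = (\<lambda>i\<in>{1..arity T P}. (g \<circ> f) (\<alpha> i))"
      by (auto simp: \<beta>_def fun_eq_iff)
    ultimately show "\<alpha> \<in> rel M P \<longleftrightarrow> (\<lambda>i\<in>{1..arity T P}. (g \<circ> f) (\<alpha> i)) \<in> rel L P"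
      using rf[OF P \<alpha>] rg[OF P, of \<beta>] by (simp add: \<beta>_def)
  qed
qed

lemma iso_cong_right: "iso T M M' \<Longrightarrow> iso T N M \<longleftrightarrow> iso T N M'"
  by (blast intro: iso_trans iso_sym)

lemma iso_cong_left: "iso T N N' \<Longrightarrow> iso T N M \<longleftrightarrow> iso T N' M"
  by (blast intro: iso_trans iso_sym)

lemma iso_card: "iso T M N \<Longrightarrow> card (verts M) = card (verts N)"
  unfolding iso_def by (auto dest: bij_betw_same_card)

lemma iso_class_cong: "iso T M N \<Longrightarrow> iso_class T M = iso_class T N"
  unfolding iso_class_def using iso_cong_left by blast

text \<open>Vertices range over arbitrary finite sets of naturals, so there are infinitely many
  models of a given size. Transport along a bijection provides representatives on an interval, of
  which \<open>finite_structs_on\<close> leaves only finitely many.\<close>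

lemma ex_iso_struct_on_interval:
  assumes M: "is_struct T M" "finite (verts M)"
  obtains M' where "is_struct T M'" "verts M' = {1..card (verts M)}" "iso T M M'"
proof -
  obtain f where f: "bij_betw f (verts M) {1..card (verts M)}"
    using M(2) by (metis ex_bij_betw_nat_finite_1 bij_betw_inv)
  define M' where "M' = \<lparr>verts = {1..card (verts M)},
     rel = (\<lambda>P. (\<lambda>\<alpha>. \<lambda>i\<in>{1..arity T P}. f (\<alpha> i)) ` rel M P)\<rparr>"
  have "is_struct T M'"
    using M(1) f unfolding is_struct_def M'_def bij_betw_def
    by (fastforce simp: PiE_iff)
  moreover have "iso T M M'"
    unfolding iso_def
  proof (intro exI[of _ f] conjI ballI iffI)
    show "bij_betw f (verts M) (verts M')"
      using f by (simp add: M'_def)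
    fix P \<alpha> assume P: "P \<in> symbols T" and \<alpha>: "\<alpha> \<in> {1..arity T P} \<rightarrow>\<^sub>E verts M"
    show "(\<lambda>i\<in>{1..arity T P}. f (\<alpha> i)) \<in> rel M' P" if "\<alpha> \<in> rel M P"
      using that by (auto simp: M'_def)
    assume "(\<lambda>i\<in>{1..arity T P}. f (\<alpha> i)) \<in> rel M' P"
    then obtain \<beta> where \<beta>: "\<beta> \<in> rel M P"
      and eq: "(\<lambda>i\<in>{1..arity T P}. f (\<alpha> i)) = (\<lambda>i\<in>{1..arity T P}. f (\<beta> i))"
      by (auto simp: M'_def)
    have \<beta>': "\<beta> \<in> {1..arity T P} \<rightarrow>\<^sub>E verts M"
      using M(1) P \<beta> unfolding is_struct_def by blast
    have "\<alpha> = \<beta>"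
    proof (rule PiE_ext[OF \<alpha> \<beta>'])
      fix i assume i: "i \<in> {1..arity T P}"
      then have "f (\<alpha> i) = f (\<beta> i)"
        using fun_cong[OF eq, of i] by simp
      then show "\<alpha> i = \<beta> i"
        using f \<alpha> \<beta>' i by (auto simp: bij_betw_def inj_on_def PiE_iff)
    qed
    with \<beta> show "\<alpha> \<in> rel M P" by simp
  qed
  ultimately show ?thesis
    by (intro that) (auto simp: M'_def)
qed

text \<open>\<open>is_struct\<close> empties every relation outside the language, so a structure
  amounts to finitely many choices of a set of tuples.\<close>

lemma finite_structs_on:
  assumes "finite (symbols T)" "finite W"
  shows "finite {M. is_struct T M \<and> verts M = W}"
proof -
  \<comment> \<open>One codomain for all symbols, whatever their arities:
    \<open>finite_set_of_finite_funs\<close> counts functions into a single finite set.\<close>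
  define B where "B = Pow (\<Union>P\<in>symbols T. {1..arity T P} \<rightarrow>\<^sub>E W)"
  have "finite B"
    unfolding B_def using assms by (auto intro: finite_PiE)
  then have "finite {R. \<forall>P. (P \<in> symbols T \<longrightarrow> R P \<in> B) \<and> (P \<notin> symbols T \<longrightarrow> R P = {})}"
    using assms by (intro finite_set_of_finite_funs)
  moreover have "{M. is_struct T M \<and> verts M = W} \<subseteq> (\<lambda>R. \<lparr>verts = W, rel = R\<rparr>) `
     {R. \<forall>P. (P \<in> symbols T \<longrightarrow> R P \<in> B) \<and> (P \<notin> symbols T \<longrightarrow> R P = {})}"
  proof
    fix M :: "'a struct" assume "M \<in> {M. is_struct T M \<and> verts M = W}"
    then show "M \<in> (\<lambda>R. \<lparr>verts = W, rel = R\<rparr>) `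
       {R. \<forall>P. (P \<in> symbols T \<longrightarrow> R P \<in> B) \<and> (P \<notin> symbols T \<longrightarrow> R P = {})}"
      by (intro image_eqI[of _ _ "rel M"]) (auto simp: is_struct_def B_def)
  qed
  ultimately show ?thesis
    by (meson finite_imageI finite_subset)
qed

section \<open>Induced substructures, densities and counting\<close>

lemma verts_induced [simp]: "verts (induced T M W) = W"
  by (simp add: induced_def)

lemma induced_induced: "W \<subseteq> V \<Longrightarrow> induced T (induced T M V) W = induced T M W"
  by (auto simp: induced_def fun_eq_iff)

lemma is_struct_induced:
  assumes "is_struct T M" shows "is_struct T (induced T M W)"
proof -
  have "\<alpha> \<in> {1..arity T P} \<rightarrow>\<^sub>E W"
    if "\<alpha> \<in> {1..arity T P} \<rightarrow>\<^sub>E verts M" "\<alpha> ` {1..arity T P} \<subseteq> W" for \<alpha> P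
    using that by auto
  with assms show ?thesis
    unfolding is_struct_def induced_def by (simp add: subset_iff)
qed

lemma is_model_induced:
  assumes M: "is_model T M" and W: "W \<subseteq> verts M"
  shows "is_model T (induced T M W)"
proof -
  have "holds T (induced T M W) v f \<longleftrightarrow> holds T M v f" if "range v \<subseteq> W" for v f
    using that by (induction f) (auto simp: induced_def)
  moreover have "range v \<subseteq> verts M" if "range v \<subseteq> W" for v :: "nat \<Rightarrow> nat"
    using that W by blast
  ultimately show ?thesis
    using M unfolding is_model_def by (simp add: is_struct_induced)
qed

lemma density_cong:
  assumes "iso T M M'" shows "density T M N = density T M' N"
  using iso_card[OF assms] iso_cong_right[OF assms] by (simp add: density_def)

text \<open>The sum in \<open>limit_reduct\<close> is only meaningful over a finite index set. All
  classes that contribute to it have one common size, and this finiteness applies to them.\<close>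

lemma finite_model_classes_of_card:
  assumes "finite (symbols T)"
  shows "finite {D \<in> model_classes T. \<exists>N\<in>D. card (verts N) = m}"
proof -
  have "{D \<in> model_classes T. \<exists>N\<in>D. card (verts N) = m} \<subseteq>
      iso_class T ` {M. is_struct T M \<and> verts M = {1..m}}"
  proof
    fix D assume "D \<in> {D \<in> model_classes T. \<exists>N\<in>D. card (verts N) = m}"
    then obtain M N where M: "M \<in> fin_models T" "D = iso_class T M" and "N \<in> D" "card (verts N) = m"
      by (auto simp: model_classes_def)
    then have "card (verts M) = m"
      by (auto simp: iso_class_def dest: iso_card)
    moreover obtain M' where "is_struct T M'" "verts M' = {1..card (verts M)}" "iso T M M'"
      using M(1) ex_iso_struct_on_interval[of T M] by (auto simp: fin_models_def is_model_def)
    ultimately show "D \<in> iso_class T ` {M. is_struct T M \<and> verts M = {1..m}}"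
      using M(2) iso_class_cong by blast
  qed
  then show ?thesis
    using finite_structs_on[OF assms, of "{1..m}"] by (meson finite_atLeastAtMost finite_imageI finite_subset)
qed

text \<open>A union bound over the points of \<open>W\<close>: a fixed point lies in (n - 1) choose
  (m - 1) of the m-sets, which is the fraction m/n of them. This is the source of the 1/n in the
  variance bound.\<close>

lemma card_subsets_meeting_le:
  fixes n m :: nat
  assumes "W \<subseteq> {1..n}" "card W = m" "n > 0"
  shows "real (card {W'. W' \<subseteq> {1..n} \<and> card W' = m \<and> W \<inter> W' \<noteq> {}}) \<le> real (m\<^sup>2 * (n choose m)) / real n"
proof -
  have finW: "finite W"
    using assms(1) finite_subset by blast
  have through: "card {W'. W' \<subseteq> {1..n} \<and> card W' = m \<and> v \<in> W'} * n \<le> m * (n choose m)"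
    if v: "v \<in> W" for v
  proof -
    have m: "m > 0"
      using v finW assms(2) by (metis card_gt_0_iff empty_iff)
    have fin: "finite {B. B \<subseteq> {1..n} - {v} \<and> card B = m - 1}"
      by (rule finite_subset[of _ "Pow {1..n}"]) auto
    have "card {W'. W' \<subseteq> {1..n} \<and> card W' = m \<and> v \<in> W'} \<le>
        card {B. B \<subseteq> {1..n} - {v} \<and> card B = m - 1}"
    proof (rule card_inj_on_le[where f = "\<lambda>W'. W' - {v}"])
      show "inj_on (\<lambda>W'. W' - {v}) {W'. W' \<subseteq> {1..n} \<and> card W' = m \<and> v \<in> W'}"
        by (auto simp: inj_on_def)
      show "(\<lambda>W'. W' - {v}) ` {W'. W' \<subseteq> {1..n} \<and> card W' = m \<and> v \<in> W'} \<subseteq>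
          {B. B \<subseteq> {1..n} - {v} \<and> card B = m - 1}"
        by (auto dest: finite_subset)
    qed (rule fin)
    also have "\<dots> = (n - 1) choose (m - 1)"
      using v assms(1) by (subst n_subsets) auto
    finally have "card {W'. W' \<subseteq> {1..n} \<and> card W' = m \<and> v \<in> W'} * n \<le>
        ((n - 1) choose (m - 1)) * n"
      by simp
    also have "\<dots> = m * (n choose m)"
      using m assms(3) times_binomial_minus1_eq[of m n] by (simp add: mult.commute)
    finally show ?thesis .
  qed
  have "{W'. W' \<subseteq> {1..n} \<and> card W' = m \<and> W \<inter> W' \<noteq> {}} =
      (\<Union>v\<in>W. {W'. W' \<subseteq> {1..n} \<and> card W' = m \<and> v \<in> W'})"
    by auto
  then have "card {W'. W' \<subseteq> {1..n} \<and> card W' = m \<and> W \<inter> W' \<noteq> {}} * n \<le>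
      (\<Sum>v\<in>W. card {W'. W' \<subseteq> {1..n} \<and> card W' = m \<and> v \<in> W'}) * n"
    by (simp only:) (intro mult_le_mono1 card_UN_le finW)
  also have "\<dots> \<le> (\<Sum>v\<in>W. m * (n choose m))"
    unfolding sum_distrib_right by (intro sum_mono through)
  also have "\<dots> = m\<^sup>2 * (n choose m)"
    by (simp add: assms(2) power2_eq_square)
  finally have "real (card {W'. W' \<subseteq> {1..n} \<and> card W' = m \<and> W \<inter> W' \<noteq> {}} * n) \<le>
      real (m\<^sup>2 * (n choose m))"
    by (rule of_nat_mono)
  then show ?thesis
    using assms(3) by (simp add: pos_le_divide_eq)
qed


section \<open>Limits of exchangeable arrays\<close>

text \<open>A class does not carry its size explicitly, hence the quantifier over \<open>m\<close>.
  All members of a class have equally many vertices, so at most one \<open>m\<close> can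
  succeed.\<close>

definition array_limit ::
  "'a measure \<Rightarrow> 'p utheory \<Rightarrow> ('a \<Rightarrow> 'p struct) \<Rightarrow> 'p struct set \<Rightarrow> real"
where
  "array_limit P T K =
     (\<lambda>C\<in>model_classes T. measure P {\<theta> \<in> space P. \<exists>m. induced T (K \<theta>) {1..m} \<in> C})"

text \<open>These are the properties that the second moment argument consumes. Exchangeability is
  asked only up to isomorphism, which is all that densities see. Measurability can be asked for an
  arbitrary predicate \<open>Q\<close> because over a finite language the sample on a finite
  \<open>W\<close> takes finitely many values.\<close>

locale dissociated_array = prob_space P
  for P :: "'a measure" +
  fixes T :: "'p utheory" and K :: "'a \<Rightarrow> 'p struct"
  assumes finite_symbols: "finite (symbols T)"
    and model: "\<theta> \<in> space P \<Longrightarrow> is_model T (K \<theta>)"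
    and verts_array: "verts (K \<theta>) = {1..}"
    and measurable_induced:
      "finite W \<Longrightarrow> W \<subseteq> {1..} \<Longrightarrow> {\<theta> \<in> space P. Q (induced T (K \<theta>) W)} \<in> events"
    and exchangeable:
      "finite W \<Longrightarrow> W \<subseteq> {1..} \<Longrightarrow>
        prob {\<theta> \<in> space P. iso T (induced T (K \<theta>) W) M} =
        prob {\<theta> \<in> space P. iso T (induced T (K \<theta>) {1..card W}) M}"
    and dissociated:
      "finite W \<Longrightarrow> W \<subseteq> {1..} \<Longrightarrow> finite W' \<Longrightarrow> W' \<subseteq> {1..} \<Longrightarrow> W \<inter> W' = {} \<Longrightarrow>
        prob {\<theta> \<in> space P. Q (induced T (K \<theta>) W) \<and> R (induced T (K \<theta>) W')} =
        prob {\<theta> \<in> space P. Q (induced T (K \<theta>) W)} * prob {\<theta> \<in> space P. R (induced T (K \<theta>) W')}"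
begin

definition copy_event :: "'p struct \<Rightarrow> nat set \<Rightarrow> 'a set" where
  "copy_event M W = {\<theta> \<in> space P. iso T (induced T (K \<theta>) W) M}"

definition copy_prob :: "'p struct \<Rightarrow> real" where
  "copy_prob M = prob (copy_event M {1..card (verts M)})"

lemma copy_event_measurable: "finite W \<Longrightarrow> W \<subseteq> {1..} \<Longrightarrow> copy_event M W \<in> events"
  unfolding copy_event_def by (rule measurable_induced)

lemma prob_copy_event:
  "finite W \<Longrightarrow> W \<subseteq> {1..} \<Longrightarrow> card W = card (verts M) \<Longrightarrow> prob (copy_event M W) = copy_prob M"
  unfolding copy_event_def copy_prob_def using exchangeable[of W M] by simp

lemma copy_prob_cong: "iso T M M' \<Longrightarrow> copy_prob M = copy_prob M'"
  unfolding copy_prob_def copy_event_def using iso_cong_right[of T M M'] iso_card[of T M M'] by simp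

lemma induced_in_fin_models:
  "\<theta> \<in> space P \<Longrightarrow> finite W \<Longrightarrow> W \<subseteq> {1..} \<Longrightarrow> induced T (K \<theta>) W \<in> fin_models T"
  by (simp add: fin_models_def verts_array is_model_induced model)

lemma ex_induced_in_iso_class:
  assumes "M \<in> fin_models T" "\<theta> \<in> space P"
  shows "(\<exists>m. induced T (K \<theta>) {1..m} \<in> iso_class T M) \<longleftrightarrow>
    iso T (induced T (K \<theta>) {1..card (verts M)}) M"
proof
  assume "\<exists>m. induced T (K \<theta>) {1..m} \<in> iso_class T M"
  then obtain m where "iso T M (induced T (K \<theta>) {1..m})"
    by (auto simp: iso_class_def)
  moreover from iso_card[OF this] have "m = card (verts M)"
    by simp
  ultimately show "iso T (induced T (K \<theta>) {1..card (verts M)}) M"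
    by (auto intro: iso_sym)
next
  assume "iso T (induced T (K \<theta>) {1..card (verts M)}) M"
  moreover have "induced T (K \<theta>) {1..card (verts M)} \<in> fin_models T"
    using assms(2) by (rule induced_in_fin_models) auto
  ultimately show "\<exists>m. induced T (K \<theta>) {1..m} \<in> iso_class T M"
    unfolding iso_class_def by (blast intro: iso_sym)
qed

lemma array_limit_iso_class:
  assumes "M \<in> fin_models T"
  shows "array_limit P T K (iso_class T M) = copy_prob M"
proof -
  have "{\<theta> \<in> space P. \<exists>m. induced T (K \<theta>) {1..m} \<in> iso_class T M} =
      copy_event M {1..card (verts M)}"
    unfolding copy_event_def using ex_induced_in_iso_class[OF assms] by blast
  with assms show ?thesis
    by (simp add: array_limit_def model_classes_def copy_prob_def)
qed

text \<open>The deviation of the density is the average of the centred indicators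
  \<open>X W\<close>. Products for disjoint sets have expectation 0 by dissociation, the others at
  most 1, and by \<open>card_subsets_meeting_le\<close> at most the fraction m^2/n of all pairs
  meet.\<close>

lemma density_second_moment:
  assumes n: "card (verts M) \<le> n" "0 < n"
  defines "D \<equiv> \<lambda>\<theta>. (density T M (induced T (K \<theta>) {1..n}) - copy_prob M)\<^sup>2"
  shows "integrable P D" "expectation D \<le> (card (verts M))\<^sup>2 / n"
proof -
  define m where "m = card (verts M)"
  define F where "F = {W. W \<subseteq> {1..n} \<and> card W = m}"
  define q where "q = copy_prob M"
  define X where "X W \<theta> = indicat_real (copy_event M W) \<theta> - q" for W \<theta>
  have finF: "finite F"
    unfolding F_def by (rule finite_subset[of _ "Pow {1..n}"]) auto
  have cardF: "card F = n choose m"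
    unfolding F_def by (subst n_subsets) auto
  then have F_pos: "card F > 0"
    using n m_def by simp
  have F: "finite W" "W \<subseteq> {1..}" if "W \<in> F" for W
    using that finite_subset[of W "{1..n}"] by (auto simp: F_def)
  have ev [measurable]: "copy_event M W \<in> events" if "W \<in> F" for W
    using F[OF that] by (rule copy_event_measurable)
  have pr: "prob (copy_event M W) = q" if "W \<in> F" for W
    unfolding q_def using F[OF that] that by (intro prob_copy_event) (auto simp: F_def m_def)
  \<comment> \<open>A crude bound is enough here: it only secures integrability and does not enter
    the estimate.\<close>
  have int: "integrable P (\<lambda>\<theta>. X V \<theta> * X W \<theta>)" if "V \<in> F" "W \<in> F" for V W
  proof (rule integrable_const_bound[where B = "(1 + \<bar>q\<bar>) * (1 + \<bar>q\<bar>)"])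
    show "(\<lambda>\<theta>. X V \<theta> * X W \<theta>) \<in> borel_measurable P"
      unfolding X_def using that by measurable
    have "\<bar>X V \<theta>\<bar> \<le> 1 + \<bar>q\<bar>" for V \<theta>
      unfolding X_def by (auto simp: indicator_def)
    then show "AE \<theta> in P. norm (X V \<theta> * X W \<theta>) \<le> (1 + \<bar>q\<bar>) * (1 + \<bar>q\<bar>)"
      by (auto simp: abs_mult intro!: mult_mono)
  qed
  have cov: "expectation (\<lambda>\<theta>. X V \<theta> * X W \<theta>) \<le> of_bool (V \<inter> W \<noteq> {})"
    if VW: "V \<in> F" "W \<in> F" for V W
  proof -
    have "X V \<theta> * X W \<theta> = indicat_real (copy_event M V \<inter> copy_event M W) \<theta>
        - q * indicat_real (copy_event M V) \<theta> - q * indicat_real (copy_event M W) \<theta> + q * q" for \<theta>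
      unfolding X_def by (auto simp: indicator_def algebra_simps)
    then have "expectation (\<lambda>\<theta>. X V \<theta> * X W \<theta>) =
        prob (copy_event M V \<inter> copy_event M W) - q * q"
      using VW by (simp add: pr prob_space integrable_indicator_iff emeasure_eq_measure
          sets.Int ev Int_absorb1 sets.sets_into_space)
    moreover have "prob (copy_event M V \<inter> copy_event M W) = q * q" if "V \<inter> W = {}"
    proof -
      have "copy_event M V \<inter> copy_event M W =
          {\<theta> \<in> space P. iso T (induced T (K \<theta>) V) M \<and> iso T (induced T (K \<theta>) W) M}"
        by (auto simp: copy_event_def)
      then show ?thesis
        using dissociated[of V W "\<lambda>N. iso T N M" "\<lambda>N. iso T N M"] F VW that pr
        by (simp add: copy_event_def)
    qed
    moreover have "prob (copy_event M V \<inter> copy_event M W) - q * q \<le> 1"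
      using prob_le_1[of "copy_event M V \<inter> copy_event M W"] zero_le_square[of q] by linarith
    ultimately show ?thesis
      by auto
  qed
  have D: "D \<theta> = (\<Sum>V\<in>F. \<Sum>W\<in>F. X V \<theta> * X W \<theta>) / (real (card F))\<^sup>2" if "\<theta> \<in> space P" for \<theta>
  proof -
    have "{W. W \<subseteq> {1..n} \<and> card W = m \<and> iso T (induced T (induced T (K \<theta>) {1..n}) W) M} =
        F \<inter> {W. \<theta> \<in> copy_event M W}"
      using that by (auto simp: F_def copy_event_def induced_induced)
    then have "density T M (induced T (K \<theta>) {1..n}) = real (card (F \<inter> {W. \<theta> \<in> copy_event M W})) / real (card F)"
      by (simp add: density_def cardF m_def)
    also have "real (card (F \<inter> {W. \<theta> \<in> copy_event M W})) = (\<Sum>W\<in>F. indicat_real (copy_event M W) \<theta>)"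
      using finF by (simp add: indicator_def sum_of_bool_eq)
    also have "\<dots> = (\<Sum>W\<in>F. X W \<theta>) + card F * q"
      by (simp add: X_def sum_subtractf)
    finally have "density T M (induced T (K \<theta>) {1..n}) - q = (\<Sum>W\<in>F. X W \<theta>) / card F"
      using F_pos by (simp add: field_simps)
    then show ?thesis
      by (simp add: D_def q_def power_divide power2_eq_square sum_product)
  qed
  have "integrable P (\<lambda>\<theta>. (\<Sum>V\<in>F. \<Sum>W\<in>F. X V \<theta> * X W \<theta>) / (real (card F))\<^sup>2)"
    by (intro integrable_divide Bochner_Integration.integrable_sum int)
  moreover have "integrable P D \<longleftrightarrow>
      integrable P (\<lambda>\<theta>. (\<Sum>V\<in>F. \<Sum>W\<in>F. X V \<theta> * X W \<theta>) / (real (card F))\<^sup>2)"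
    by (rule Bochner_Integration.integrable_cong) (simp_all only: D)
  ultimately show "integrable P D"
    by (simp only:)
  have "expectation D = expectation (\<lambda>\<theta>. (\<Sum>V\<in>F. \<Sum>W\<in>F. X V \<theta> * X W \<theta>) / (real (card F))\<^sup>2)"
    by (intro Bochner_Integration.integral_cong refl D)
  also have "\<dots> = (\<Sum>V\<in>F. \<Sum>W\<in>F. expectation (\<lambda>\<theta>. X V \<theta> * X W \<theta>)) / (real (card F))\<^sup>2"
    by (simp add: Bochner_Integration.integral_sum Bochner_Integration.integrable_sum int)
  also have "\<dots> \<le> (\<Sum>V\<in>F. \<Sum>W\<in>F. of_bool (V \<inter> W \<noteq> {})) / (real (card F))\<^sup>2"
    by (intro divide_right_mono sum_mono cov) auto
  also have "\<dots> \<le> (\<Sum>V\<in>F. real (m\<^sup>2 * card F) / n) / (real (card F))\<^sup>2"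
  proof (intro divide_right_mono sum_mono)
    fix V assume V: "V \<in> F"
    have "F \<inter> {W. V \<inter> W \<noteq> {}} = {W. W \<subseteq> {1..n} \<and> card W = m \<and> V \<inter> W \<noteq> {}}"
      by (auto simp: F_def)
    then have "(\<Sum>W\<in>F. of_bool (V \<inter> W \<noteq> {})) = real (card {W. W \<subseteq> {1..n} \<and> card W = m \<and> V \<inter> W \<noteq> {}})"
      using finF by (simp only: sum_of_bool_eq)
    also have "\<dots> \<le> real (m\<^sup>2 * card F) / n"
      unfolding cardF using V n by (intro card_subsets_meeting_le) (auto simp: F_def)
    finally show "(\<Sum>W\<in>F. of_bool (V \<inter> W \<noteq> {})) \<le> real (m\<^sup>2 * card F) / n" .
  qed auto
  also have "\<dots> = m\<^sup>2 / n"
    using F_pos by (simp add: power2_eq_square)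
  finally show "expectation D \<le> (card (verts M))\<^sup>2 / n"
    by (simp add: m_def)
qed

text \<open>Some point does no worse than the expectation. Summing the squared errors over
  \<open>F\<close> first makes one \<theta> serve all models in \<open>F\<close> at once, so almost
  sure convergence never has to be established.\<close>

lemma ex_good_sample:
  assumes "finite F" "\<And>M. M \<in> F \<Longrightarrow> card (verts M) \<le> n" "0 < n"
  shows "\<exists>\<theta>\<in>space P. (\<Sum>M\<in>F. (density T M (induced T (K \<theta>) {1..n}) - copy_prob M)\<^sup>2) \<le>
    (\<Sum>M\<in>F. (card (verts M))\<^sup>2) / n"
proof (rule ccontr)
  let ?S = "\<lambda>\<theta>. \<Sum>M\<in>F. (density T M (induced T (K \<theta>) {1..n}) - copy_prob M)\<^sup>2"
  assume "\<not> ?thesis"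
  then have "AE \<theta> in P. (\<Sum>M\<in>F. (card (verts M))\<^sup>2) / n < ?S \<theta>"
    by (intro AE_I2) (auto simp: not_le)
  then have "(\<Sum>M\<in>F. (card (verts M))\<^sup>2) / n < expectation ?S"
    using assms by (intro expectation_greater Bochner_Integration.integrable_sum density_second_moment)
  also have "\<dots> = (\<Sum>M\<in>F. expectation (\<lambda>\<theta>. (density T M (induced T (K \<theta>) {1..n}) - copy_prob M)\<^sup>2))"
    using assms by (intro Bochner_Integration.integral_sum density_second_moment)
  also have "\<dots> \<le> (\<Sum>M\<in>F. (card (verts M))\<^sup>2 / n)"
    using assms by (intro sum_mono density_second_moment)
  also have "\<dots> = (\<Sum>M\<in>F. (card (verts M))\<^sup>2) / n"
    by (simp add: sum_divide_distrib)
  finally show False by simp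
qed

theorem array_limit_in_Hom_plus: "array_limit P T K \<in> Hom_plus T"
proof -
  define F where "F j = {M. is_struct T M \<and> (\<exists>m\<le>j. verts M = {1..m})}" for j :: nat
  define c where "c j = (\<Sum>M\<in>F j. (card (verts M))\<^sup>2)" for j
  \<comment> \<open>Stage \<open>j\<close> controls all structures with at most \<open>j\<close>
    vertices. This size exceeds \<open>j\<close>, so that they fit into the sample; it is strictly
    increasing because \<open>c\<close> is monotone; and it pushes the total error
    \<open>c j / n j\<close> below 1/(j + 1). The summand 1 keeps it positive when
    \<open>c j\<close> is 0.\<close>
  define n where "n j = (j + 1) * (c j + 1)" for j
  have finF: "finite (F j)" for j
  proof -
    have "F j = (\<Union>m\<le>j. {M. is_struct T M \<and> verts M = {1..m}})"
      by (auto simp: F_def)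
    then show ?thesis
      using finite_structs_on[OF finite_symbols] by simp
  qed
  have "F i \<subseteq> F j" if "i \<le> j" for i j
    using that by (fastforce simp: F_def)
  then have "c i \<le> c j" if "i \<le> j" for i j
    unfolding c_def using that finF by (intro sum_mono2) auto
  then have n_mono: "strict_mono n"
    unfolding n_def by (intro strict_monoI mult_less_le_imp_less) (simp_all add: less_imp_le)
  have n_ge: "j < n j" for j
    by (simp add: n_def)
  have "\<exists>\<theta>\<in>space P. (\<Sum>M\<in>F j. (density T M (induced T (K \<theta>) {1..n j}) - copy_prob M)\<^sup>2) \<le> c j / n j" for j
    unfolding c_def using finF n_ge[of j] by (intro ex_good_sample) (auto simp: F_def)
  then obtain \<theta> where \<theta>: "\<And>j. \<theta> j \<in> space P"
    and approx: "\<And>j. (\<Sum>M\<in>F j. (density T M (induced T (K (\<theta> j)) {1..n j}) - copy_prob M)\<^sup>2) \<le> c j / n j"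
    by metis
  define N where "N j = induced T (K (\<theta> j)) {1..n j}" for j
  have "(\<lambda>j. density T M (N j)) \<longlonglongrightarrow> copy_prob M" if M: "M \<in> fin_models T" for M
  proof -
    \<comment> \<open>\<open>F j\<close> contains only structures on initial intervals. The
      representative \<open>M'\<close> belongs to it from stage \<open>card (verts M)\<close> on,
      and densities and copy probabilities do not distinguish it from \<open>M\<close>.\<close>
    obtain M' where M': "is_struct T M'" "verts M' = {1..card (verts M)}" "iso T M M'"
      using M ex_iso_struct_on_interval[of T M] by (auto simp: fin_models_def is_model_def)
    let ?d = "\<lambda>j. density T M' (N j) - copy_prob M'"
    have "(?d j)\<^sup>2 \<le> inverse (real (Suc j))" if "card (verts M) \<le> j" for j
    proof -
      have "(?d j)\<^sup>2 \<le> (\<Sum>M\<in>F j. (density T M (N j) - copy_prob M)\<^sup>2)"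
        using M' that by (intro member_le_sum finF) (auto simp: F_def)
      also have "\<dots> \<le> c j / n j"
        using approx unfolding N_def .
      also have "\<dots> \<le> inverse (real (Suc j))"
      proof -
        have "real (c j) * real (Suc j) \<le> real (n j)"
          by (simp add: n_def algebra_simps)
        then show ?thesis
          using n_ge[of j] by (simp add: divide_le_eq le_divide_eq inverse_eq_divide mult.commute del: of_nat_Suc)
      qed
      finally show ?thesis .
    qed
    then have "\<forall>\<^sub>F j in sequentially. (?d j)\<^sup>2 \<le> inverse (real (Suc j))"
      unfolding eventually_sequentially by blast
    then have "(\<lambda>j. (?d j)\<^sup>2) \<longlonglongrightarrow> 0"
      by (intro tendsto_sandwich[OF _ _ tendsto_const LIMSEQ_inverse_real_of_nat]) auto
    from tendsto_real_sqrt[OF this] have "(\<lambda>j. density T M' (N j)) \<longlonglongrightarrow> copy_prob M'"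
      by (simp add: tendsto_rabs_zero_iff LIM_zero_iff)
    then show ?thesis
      using density_cong[OF M'(3)] copy_prob_cong[OF M'(3)] by simp
  qed
  moreover have "N j \<in> fin_models T" for j
    unfolding N_def by (intro induced_in_fin_models \<theta>) auto
  moreover have "strict_mono (\<lambda>j. card (verts (N j)))"
    using n_mono by (simp add: N_def)
  ultimately show ?thesis
    unfolding Hom_plus_def using array_limit_iso_class
    by (auto simp: array_limit_def[of P T K] intro!: exI[of _ N])
qed

end

text \<open>The event that the \<open>T\<close>-sample falls into \<open>C\<close> is partitioned by
  the class of the \<open>U\<close>-sample above it; finite additivity turns this into the sum in
  \<open>limit_reduct\<close>. Reducts preserve isomorphism, so one member of a class with reduct in
  \<open>C\<close> speaks for the whole class.\<close>

lemma limit_reduct_array_limit: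
  assumes "dissociated_array P T K" "dissociated_array P U L"
    and sym: "c ` symbols T \<subseteq> symbols U" and ar: "\<And>p. arity U (c p) = arity T p"
    and K: "\<And>\<theta>. \<theta> \<in> space P \<Longrightarrow> reduct c (L \<theta>) = K \<theta>"
  shows "limit_reduct c T U (array_limit P U L) = array_limit P T K"
proof
  interpret T: dissociated_array P T K by fact
  interpret U: dissociated_array P U L by fact
  have red: "reduct c (induced U (L \<theta>) W) = induced T (K \<theta>) W" if "\<theta> \<in> space P" for \<theta> W
    unfolding K[OF that, symmetric] by (simp add: reduct_def induced_def ar)
  have red_iso: "iso T (reduct c M) (reduct c N)" if MN: "iso U M N" for M N
  proof -
    obtain f where f: "bij_betw f (verts M) (verts N)"
      and r: "\<And>P \<alpha>. P \<in> symbols U \<Longrightarrow> \<alpha> \<in> {1..arity U P} \<rightarrow>\<^sub>E verts M \<Longrightarrow>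
         \<alpha> \<in> rel M P \<longleftrightarrow> (\<lambda>i\<in>{1..arity U P}. f (\<alpha> i)) \<in> rel N P"
      using MN unfolding iso_def by blast
    have "\<alpha> \<in> rel M (c p) \<longleftrightarrow> (\<lambda>i\<in>{1..arity T p}. f (\<alpha> i)) \<in> rel N (c p)"
      if "p \<in> symbols T" "\<alpha> \<in> {1..arity T p} \<rightarrow>\<^sub>E verts M" for p \<alpha>
      using r[of "c p" \<alpha>] that sym by (auto simp: ar)
    with f show ?thesis
      unfolding iso_def reduct_def by (intro exI[of _ f]) simp
  qed
  fix C
  show "limit_reduct c T U (array_limit P U L) C = array_limit P T K C"
  proof (cases "C \<in> model_classes T")
    case False
    then show ?thesis
      by (simp add: limit_reduct_def array_limit_def)
  next
    case True
    then obtain M where M: "M \<in> fin_models T" and C: "C = iso_class T M"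
      by (auto simp: model_classes_def)
    define \<D> where "\<D> = {D \<in> model_classes U. \<exists>N\<in>D. reduct c N \<in> C}"
    define E where "E D = {\<theta> \<in> space P. \<exists>m. induced U (L \<theta>) {1..m} \<in> D}" for D
    have card_C: "card (verts N) = card (verts M)" if "reduct c N \<in> C" for N
      using that iso_card[of T M "reduct c N"] by (simp add: C iso_class_def reduct_def)
    have "finite \<D>"
      by (rule finite_subset[OF _ finite_model_classes_of_card[OF U.finite_symbols, of "card (verts M)"]])
        (auto simp: \<D>_def dest: card_C)
    \<comment> \<open>This removes the quantifier over the sample size: every class in \<D> is
      witnessed by the same sample, and disjointness of the events reduces to disjointness of
      classes.\<close>
    have sample: "N' = induced U (L \<theta>) {1..card (verts M)}"
      if D: "D \<in> \<D>" and N': "N' = induced U (L \<theta>) {1..m}" "N' \<in> D" for D \<theta> m N'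
    proof -
      obtain M' N where "D = iso_class U M'" "N \<in> D" "reduct c N \<in> C"
        using D by (auto simp: \<D>_def model_classes_def)
      then have "card (verts N') = card (verts M)"
        using N'(2) card_C iso_card[of U M' N] iso_card[of U M' N'] by (simp add: iso_class_def)
      with N'(1) show ?thesis
        by simp
    qed
    have disj: "disjoint_family_on E \<D>"
    proof (unfold disjoint_family_on_def, intro ballI impI, rule ccontr)
      fix D D' assume D: "D \<in> \<D>" "D' \<in> \<D>" "D \<noteq> D'" and "E D \<inter> E D' \<noteq> {}"
      then obtain \<theta> where \<theta>: "\<theta> \<in> E D" "\<theta> \<in> E D'"
        by blast
      define N where "N = induced U (L \<theta>) {1..card (verts M)}"
      have "N \<in> D" "N \<in> D'"
        using \<theta> sample[OF D(1)] sample[OF D(2)] unfolding E_def N_def by (auto, metis+)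
      moreover obtain M1 M2 where "D = iso_class U M1" "D' = iso_class U M2"
        using D by (auto simp: \<D>_def model_classes_def)
      ultimately have "iso U M1 N" "iso U M2 N"
        by (auto simp: iso_class_def)
      then have "iso U M1 M2"
        by (blast intro: iso_trans iso_sym)
      then show False
        using D(3) \<open>D = _\<close> \<open>D' = _\<close> iso_class_cong by blast
    qed
    have meas: "E D \<in> sets P" if D: "D \<in> \<D>" for D
    proof -
      obtain N where N: "N \<in> fin_models U" "D = iso_class U N"
        using D by (auto simp: \<D>_def model_classes_def)
      then have "E D = U.copy_event N {1..card (verts N)}"
        unfolding E_def U.copy_event_def using U.ex_induced_in_iso_class by blast
      then show ?thesis
        by (simp add: U.copy_event_measurable)
    qed
    have "(\<Union>D\<in>\<D>. E D) = {\<theta> \<in> space P. \<exists>m. induced T (K \<theta>) {1..m} \<in> C}"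
    proof (intro equalityI subsetI)
      fix \<theta> assume "\<theta> \<in> (\<Union>D\<in>\<D>. E D)"
      then obtain D m where D: "D \<in> \<D>" and \<theta>: "\<theta> \<in> space P" and m: "induced U (L \<theta>) {1..m} \<in> D"
        by (auto simp: E_def)
      obtain M' N where "D = iso_class U M'" "N \<in> D" and N: "reduct c N \<in> C"
        using D by (auto simp: \<D>_def model_classes_def)
      with m have "iso U M' N" "iso U M' (induced U (L \<theta>) {1..m})"
        by (auto simp: iso_class_def)
      then have "iso U N (induced U (L \<theta>) {1..m})"
        by (blast intro: iso_trans iso_sym)
      then have "iso T (reduct c N) (induced T (K \<theta>) {1..m})"
        using red_iso red[OF \<theta>] by metis
      moreover have "iso T M (reduct c N)"
        using N by (simp add: C iso_class_def)
      ultimately have "induced T (K \<theta>) {1..m} \<in> C"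
        unfolding C iso_class_def using T.induced_in_fin_models[OF \<theta>, of "{1..m}"]
        by (auto intro: iso_trans)
      with \<theta> show "\<theta> \<in> {\<theta> \<in> space P. \<exists>m. induced T (K \<theta>) {1..m} \<in> C}"
        by blast
    next
      fix \<theta> assume "\<theta> \<in> {\<theta> \<in> space P. \<exists>m. induced T (K \<theta>) {1..m} \<in> C}"
      then obtain m where \<theta>: "\<theta> \<in> space P" and m: "induced T (K \<theta>) {1..m} \<in> C"
        by blast
      let ?N = "induced U (L \<theta>) {1..m}"
      have N: "?N \<in> fin_models U"
        using \<theta> by (rule U.induced_in_fin_models) auto
      then have "?N \<in> iso_class U ?N"
        by (simp add: iso_class_def iso_refl)
      moreover from this m have "iso_class U ?N \<in> \<D>"
        unfolding \<D>_def using N red[OF \<theta>, of "{1..m}"]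
        by (auto simp: model_classes_def intro!: bexI[of _ ?N])
      ultimately show "\<theta> \<in> (\<Union>D\<in>\<D>. E D)"
        using \<theta> unfolding E_def by blast
    qed
    then have "array_limit P T K C = measure P (\<Union>D\<in>\<D>. E D)"
      using True by (simp add: array_limit_def)
    also have "\<dots> = (\<Sum>D\<in>\<D>. measure P (E D))"
      using \<open>finite \<D>\<close> disj meas by (intro T.finite_measure_finite_Union) auto
    also have "\<dots> = (\<Sum>D\<in>\<D>. array_limit P U L D)"
      by (intro sum.cong) (auto simp: \<D>_def E_def array_limit_def)
    also have "\<dots> = limit_reduct c T U (array_limit P U L) C"
      using True by (simp add: limit_reduct_def \<D>_def)
    finally show ?thesis ..
  qed
qed


section \<open>The array of a theon\<close>

lemma is_struct_exch_array: "is_struct T (exch_array T \<N> \<theta>)"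
  by (auto simp: is_struct_def exch_array_def)

lemma verts_exch_array [simp]: "verts (exch_array T \<N> \<theta>) = {1..}"
  by (simp add: exch_array_def)

lemma image_in_fin_subsets: "A \<in> fin_subsets V \<Longrightarrow> \<alpha> ` V \<subseteq> W \<Longrightarrow> \<alpha> ` A \<in> fin_subsets W"
  by (auto simp: fin_subsets_def)

text \<open>The source of dissociation: tuples with entries in \<open>W\<close> read only
  coordinates indexed by subsets of \<open>W\<close>.\<close>

lemma induced_exch_array_cong:
  assumes "\<And>A. A \<in> fin_subsets W \<Longrightarrow> \<theta> A = \<theta>' A"
  shows "induced T (exch_array T \<N> \<theta>) W = induced T (exch_array T \<N> \<theta>') W"
proof -
  have "pullback m \<alpha> \<theta> = pullback m \<alpha> \<theta>'" if "\<alpha> ` {1..m} \<subseteq> W" for m \<alpha>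
    unfolding pullback_def
    using image_in_fin_subsets[OF _ that] assms by (auto simp: fun_eq_iff restrict_def)
  then have "{\<alpha> \<in> rel (exch_array T \<N> \<theta>) P. \<alpha> ` {1..arity T P} \<subseteq> W} =
      {\<alpha> \<in> rel (exch_array T \<N> \<theta>') P. \<alpha> ` {1..arity T P} \<subseteq> W}" for P
    by (simp add: exch_array_def cong: rev_conj_cong)
  then show ?thesis
    by (simp only: induced_def)
qed

lemma pullback_pullback:
  "\<alpha> ` {1..m} \<subseteq> {1..n} \<Longrightarrow> pullback m \<alpha> (pullback n \<sigma> \<theta>) = pullback m (\<lambda>i\<in>{1..m}. \<sigma> (\<alpha> i)) \<theta>"
proof -
  assume *: "\<alpha> ` {1..m} \<subseteq> {1..n}"
  have "(\<lambda>i\<in>{1..m}. \<sigma> (\<alpha> i)) ` A = \<sigma> ` \<alpha> ` A" if "A \<in> fin_subsets {1..m}" for A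
    using that by (auto simp: fin_subsets_def image_iff subset_iff)
  then show ?thesis
    unfolding pullback_def using image_in_fin_subsets[OF _ *] by (auto simp: fun_eq_iff restrict_def)
qed

text \<open>The source of exchangeability: relabelling vertices by \<sigma> is the same as pulling
  back the coordinates. Since \<sigma> is just a bijection onto \<open>W\<close>, no permutation of
  all vertices has to be built.\<close>

lemma iso_induced_exch_array_pullback:
  assumes "bij_betw \<sigma> {1..n} W" "W \<subseteq> {1..}"
  shows "iso T (induced T (exch_array T \<N> (pullback n \<sigma> \<theta>)) {1..n}) (induced T (exch_array T \<N> \<theta>) W)"
  unfolding iso_def
proof (intro exI[of _ \<sigma>] conjI ballI)
  show "bij_betw \<sigma> (verts (induced T (exch_array T \<N> (pullback n \<sigma> \<theta>)) {1..n}))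
      (verts (induced T (exch_array T \<N> \<theta>) W))"
    using assms(1) by simp
  fix P \<alpha> assume P: "P \<in> symbols T"
    and "\<alpha> \<in> {1..arity T P} \<rightarrow>\<^sub>E verts (induced T (exch_array T \<N> (pullback n \<sigma> \<theta>)) {1..n})"
  then have \<alpha>: "\<alpha> \<in> {1..arity T P} \<rightarrow>\<^sub>E {1..n}"
    by simp
  define \<beta> where "\<beta> = (\<lambda>i\<in>{1..arity T P}. \<sigma> (\<alpha> i))"
  have \<alpha>_img: "\<alpha> ` {1..arity T P} \<subseteq> {1..n}"
    using \<alpha> by auto
  have \<sigma>: "inj_on \<sigma> {1..n}" "\<sigma> ` {1..n} = W"
    using assms(1) by (auto simp: bij_betw_def)
  have "\<beta> ` {1..arity T P} \<subseteq> W"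
    using \<alpha>_img \<sigma>(2) by (auto simp: \<beta>_def)
  moreover from this have "\<beta> \<in> {1..arity T P} \<rightarrow>\<^sub>E {1..}"
    using assms(2) by (auto simp: \<beta>_def)
  moreover have "\<alpha> \<in> {1..arity T P} \<rightarrow>\<^sub>E {1..}"
    using \<alpha> PiE_mono[of "{1..arity T P}" "\<lambda>_. {1..n}" "\<lambda>_. {1..}"] by auto
  moreover have "inj_on \<beta> {1..arity T P} \<longleftrightarrow> inj_on (\<sigma> \<circ> \<alpha>) {1..arity T P}"
    by (rule inj_on_cong) (simp add: \<beta>_def)
  then have "inj_on \<beta> {1..arity T P} \<longleftrightarrow> inj_on \<alpha> {1..arity T P}"
    using inj_on_subset[OF \<sigma>(1) \<alpha>_img] by (metis comp_inj_on inj_on_imageI2)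
  moreover have "pullback (arity T P) \<alpha> (pullback n \<sigma> \<theta>) = pullback (arity T P) \<beta> \<theta>"
    unfolding \<beta>_def by (rule pullback_pullback[OF \<alpha>_img])
  ultimately show "\<alpha> \<in> rel (induced T (exch_array T \<N> (pullback n \<sigma> \<theta>)) {1..n}) P \<longleftrightarrow>
      (\<lambda>i\<in>{1..arity T P}. \<sigma> (\<alpha> i)) \<in> rel (induced T (exch_array T \<N> \<theta>) W) P"
    using P \<alpha>_img unfolding \<beta>_def[symmetric] by (simp add: induced_def exch_array_def)
qed

lemma (in product_prob_space) indep_vars_coordinates:
  assumes "I \<noteq> {}" shows "P.indep_vars M (\<lambda>i \<omega>. \<omega> i) I"
proof (subst P.indep_vars_iff_distr_eq_PiM'[OF assms])
  have "distr (PiM I M) (PiM I M) (\<lambda>x. \<lambda>i\<in>I. x i) = distr (PiM I M) (PiM I M) (\<lambda>x. x)"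
    by (intro distr_cong) (auto simp: space_PiM)
  also have "\<dots> = PiM I M"
    by simp
  also have "\<dots> = PiM I (\<lambda>i. distr (PiM I M) (M i) (\<lambda>x. x i))"
    by (intro PiM_cong refl PiM_component[symmetric])
  finally show "distr (PiM I M) (PiM I M) (\<lambda>x. \<lambda>i\<in>I. x i) =
      PiM I (\<lambda>i. distr (PiM I M) (M i) (\<lambda>x. x i))" .
qed simp

text \<open>Stricter than \<open>theon\<close> in two ways: the peons lie in the product
  sigma-algebra before completion, where reindexing and independence of coordinates are available,
  and the axioms hold at every point, as \<open>dissociated_array\<close> demands.\<close>

locale borel_theon = prob_space \<Omega>
  for \<Omega> :: "'x measure" +
  fixes T :: "'p utheory" and \<N> :: "'p \<Rightarrow> (nat set \<Rightarrow> 'x) set"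
  assumes finite_symbols: "finite (symbols T)"
    and peon_measurable:
      "P \<in> symbols T \<Longrightarrow> \<N> P \<in> sets (PiM (fin_subsets {1..arity T P}) (\<lambda>_. \<Omega>))"
    and model:
      "\<theta> \<in> space (PiM (fin_subsets {1..}) (\<lambda>_. \<Omega>)) \<Longrightarrow> is_model T (exch_array T \<N> \<theta>)"
begin

text \<open>A sample on a finite \<open>W\<close> is determined by finitely many atomic statements,
  each the preimage of a peon under a measurable pullback. The set \<open>V\<close> varies
  separately because the proof below compares the full space with the spaces over \<open>W\<close>
  and over an interval.\<close>

lemma sets_induced:
  assumes W: "finite W" "W \<subseteq> V" "W \<subseteq> {1..}"
  shows "{\<theta> \<in> space (PiM (fin_subsets V) (\<lambda>_. \<Omega>)). Q (induced T (exch_array T \<N> \<theta>) W)}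
    \<in> sets (PiM (fin_subsets V) (\<lambda>_. \<Omega>))"
proof -
  let ?E = "PiM (fin_subsets V) (\<lambda>_. \<Omega>)"
  let ?S = "\<lambda>\<theta>. induced T (exch_array T \<N> \<theta>) W"
  have rel: "{\<theta> \<in> space ?E. \<alpha> \<in> rel (?S \<theta>) P \<longleftrightarrow> b} \<in> sets ?E"
    if P: "P \<in> symbols T" and \<alpha>: "\<alpha> \<in> {1..arity T P} \<rightarrow>\<^sub>E W" for P \<alpha> b
  proof -
    have "\<alpha> ` A \<in> fin_subsets V" if "A \<in> fin_subsets {1..arity T P}" for A
      using image_in_fin_subsets[OF that, of \<alpha> V] \<alpha> W(2) by auto
    then have "pullback (arity T P) \<alpha> \<in> measurable ?E (PiM (fin_subsets {1..arity T P}) (\<lambda>_. \<Omega>))"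
      unfolding pullback_def by (intro measurable_restrict measurable_component_singleton)
    from measurable_sets[OF this peon_measurable[OF P]]
    have "{\<theta> \<in> space ?E. pullback (arity T P) \<alpha> \<theta> \<in> \<N> P} \<in> sets ?E"
      by (simp add: vimage_def Int_def conj_commute)
    then have *: "{\<theta> \<in> space ?E. inj_on \<alpha> {1..arity T P} \<and> pullback (arity T P) \<alpha> \<theta> \<in> \<N> P} \<in> sets ?E"
      by (intro sets.sets_Collect_conj sets.sets_Collect_const)
    have "\<alpha> \<in> {1..arity T P} \<rightarrow>\<^sub>E {1..}" "\<alpha> ` {1..arity T P} \<subseteq> W"
      using \<alpha> W(3) by (auto simp: PiE_iff)
    then have "\<alpha> \<in> rel (?S \<theta>) P \<longleftrightarrow> inj_on \<alpha> {1..arity T P} \<and> pullback (arity T P) \<alpha> \<theta> \<in> \<N> P" for \<theta>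
      using P by (simp add: induced_def exch_array_def)
    with * have "{\<theta> \<in> space ?E. \<alpha> \<in> rel (?S \<theta>) P} \<in> sets ?E"
      by simp
    then show ?thesis
      by (cases b) (auto intro: sets.sets_Collect_neg)
  qed
  define \<S> where "\<S> = {S. is_struct T S \<and> verts S = W}"
  have "finite \<S>"
    unfolding \<S>_def using finite_structs_on[OF finite_symbols W(1)] .
  have S: "?S \<theta> \<in> \<S>" for \<theta>
    unfolding \<S>_def by (simp add: is_struct_induced is_struct_exch_array)
  have eq: "M = N \<longleftrightarrow> (\<forall>P\<in>symbols T. \<forall>\<alpha>\<in>{1..arity T P} \<rightarrow>\<^sub>E W. \<alpha> \<in> rel M P \<longleftrightarrow> \<alpha> \<in> rel N P)"
    if MN: "M \<in> \<S>" "N \<in> \<S>" for M N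
  proof (rule iffI)
    assume *: "\<forall>P\<in>symbols T. \<forall>\<alpha>\<in>{1..arity T P} \<rightarrow>\<^sub>E W. \<alpha> \<in> rel M P \<longleftrightarrow> \<alpha> \<in> rel N P"
    have "rel M P = rel N P" for P
    proof (cases "P \<in> symbols T")
      case True
      then have "rel M P \<subseteq> {1..arity T P} \<rightarrow>\<^sub>E verts M" "rel N P \<subseteq> {1..arity T P} \<rightarrow>\<^sub>E verts N"
        using MN unfolding \<S>_def is_struct_def by blast+
      moreover have "verts M = W" "verts N = W"
        using MN by (simp_all add: \<S>_def)
      ultimately show ?thesis
        using * True by blast
    next
      case False
      then show ?thesis
        using MN by (simp add: \<S>_def is_struct_def)
    qed
    then show "M = N"
      using MN by (intro struct.equality) (auto simp: \<S>_def)
  qed simp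
  have "{\<theta> \<in> space ?E. ?S \<theta> = M} \<in> sets ?E" if "M \<in> \<S>" for M
    unfolding eq[OF S that] using finite_symbols W(1)
    by (intro sets.sets_Collect_finite_All' sets.sets_Collect_finite_All rel finite_PiE) auto
  then have "(\<Union>M\<in>{M \<in> \<S>. Q M}. {\<theta> \<in> space ?E. ?S \<theta> = M}) \<in> sets ?E"
    using \<open>finite \<S>\<close> by (intro sets.finite_UN) auto
  also have "(\<Union>M\<in>{M \<in> \<S>. Q M}. {\<theta> \<in> space ?E. ?S \<theta> = M}) = {\<theta> \<in> space ?E. Q (?S \<theta>)}"
    using S by auto
  finally show ?thesis .
qed

sublocale array: dissociated_array "PiM (fin_subsets {1..}) (\<lambda>_. \<Omega>)" T "exch_array T \<N>"
proof -
  let ?E = "\<lambda>V. PiM (fin_subsets V) (\<lambda>_. \<Omega>)"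
  let ?S = "\<lambda>W \<theta>. induced T (exch_array T \<N> \<theta>) W"
  interpret \<Theta>: product_prob_space "\<lambda>_. \<Omega>" "fin_subsets {1..}"
    by (intro product_prob_spaceI prob_space_axioms)
  \<comment> \<open>Exchangeability is obtained by sending both sides to the finite space over
    \<open>{1..card W}\<close>: the pullback along \<sigma> reindexes coordinates injectively and so
    preserves the product measure.\<close>
  have copy: "measure (?E {1..}) {\<theta> \<in> space (?E {1..}). iso T (?S W \<theta>) M} =
      measure (?E {1..card W}) {x \<in> space (?E {1..card W}). iso T (?S {1..card W} x) M}"
    if W: "finite W" "W \<subseteq> {1..}" for W M
  proof -
    obtain \<sigma> where \<sigma>: "bij_betw \<sigma> {1..card W} W"
      using W(1) ex_bij_betw_nat_finite_1 by blast
    define g :: "(nat set \<Rightarrow> 'x) \<Rightarrow> nat set \<Rightarrow> 'x" where "g = pullback (card W) \<sigma>"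
    let ?A = "{x \<in> space (?E {1..card W}). iso T (?S {1..card W} x) M}"
    have "\<Union> (fin_subsets {1..card W}) \<subseteq> {1..card W}"
      by (auto simp: fin_subsets_def)
    then have "inj_on ((`) \<sigma>) (fin_subsets {1..card W})"
      using \<sigma> by (intro inj_on_image) (auto simp: bij_betw_def intro: inj_on_subset)
    moreover have img: "(`) \<sigma> \<in> fin_subsets {1..card W} \<rightarrow> fin_subsets {1..}"
      using image_in_fin_subsets[of _ "{1..card W}" \<sigma> "{1..}"] \<sigma> W(2) by (auto simp: bij_betw_def)
    ultimately have distr: "distr (?E {1..}) (?E {1..card W}) g = ?E {1..card W}"
      unfolding g_def pullback_def by (intro distr_PiM_reindex prob_space_axioms)
    have g: "g \<in> measurable (?E {1..}) (?E {1..card W})"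
      unfolding g_def pullback_def using img
      by (intro measurable_restrict measurable_component_singleton) auto
    have iso_g: "iso T (?S {1..card W} (g \<theta>)) M \<longleftrightarrow> iso T (?S W \<theta>) M" for \<theta>
      unfolding g_def by (rule iso_cong_left[OF iso_induced_exch_array_pullback[OF \<sigma> W(2)]])
    have "measure (?E {1..card W}) ?A = measure (distr (?E {1..}) (?E {1..card W}) g) ?A"
      by (simp only: distr)
    also have "\<dots> = measure (?E {1..}) (g -` ?A \<inter> space (?E {1..}))"
      by (intro measure_distr g sets_induced) auto
    also have "g -` ?A \<inter> space (?E {1..}) = {\<theta> \<in> space (?E {1..}). iso T (?S W \<theta>) M}"
      using measurable_space[OF g] iso_g by blast
    finally show ?thesis ..
  qed
  have split: "{\<theta> \<in> space (?E {1..}). Q (?S W \<theta>)} =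
      (\<lambda>\<theta>. restrict \<theta> (fin_subsets W)) -` {x \<in> space (?E W). Q (?S W x)} \<inter> space (?E {1..})"
    if "W \<subseteq> {1..}" for Q W
  proof -
    have "?S W (restrict \<theta> (fin_subsets W)) = ?S W \<theta>" for \<theta>
      by (intro induced_exch_array_cong) simp
    moreover have "fin_subsets W \<subseteq> fin_subsets {1..}"
      using that by (auto simp: fin_subsets_def)
    then have "restrict \<theta> (fin_subsets W) \<in> space (?E W)" if "\<theta> \<in> space (?E {1..})" for \<theta>
      using that by (auto simp: space_PiM PiE_iff)
    ultimately show ?thesis
      by auto
  qed
  show "dissociated_array (?E {1..}) T (exch_array T \<N>)"
  proof
    show "measure (?E {1..}) {\<theta> \<in> space (?E {1..}). iso T (?S W \<theta>) M} =
        measure (?E {1..}) {\<theta> \<in> space (?E {1..}). iso T (?S {1..card W} \<theta>) M}"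
      if "finite W" "W \<subseteq> {1..}" for W M
      using copy[OF that] copy[of "{1..card W}"] by auto
    fix W W' :: "nat set" and Q R
    assume W: "finite W" "W \<subseteq> {1..}" "finite W'" "W' \<subseteq> {1..}" "W \<inter> W' = {}"
    let ?X = "{x \<in> space (?E W). Q (?S W x)}" and ?Y = "{x \<in> space (?E W'). R (?S W' x)}"
    have "{1} \<in> fin_subsets {1..}"
      by (simp add: fin_subsets_def)
    then have "\<Theta>.P.indep_vars (\<lambda>_. \<Omega>) (\<lambda>i \<omega>. \<omega> i) (fin_subsets {1..})"
      by (intro \<Theta>.indep_vars_coordinates) auto
    \<comment> \<open>Independence hinges on the index sets being nonempty: a coordinate at the
      empty set would be shared by all samples.\<close>
    moreover have "fin_subsets W \<inter> fin_subsets W' = {}"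
      "fin_subsets W \<subseteq> fin_subsets {1..}" "fin_subsets W' \<subseteq> fin_subsets {1..}"
      using W by (auto simp: fin_subsets_def)
    ultimately have indep: "\<Theta>.P.indep_var (?E W) (\<lambda>\<theta>. restrict \<theta> (fin_subsets W))
        (?E W') (\<lambda>\<theta>. restrict \<theta> (fin_subsets W'))"
      using \<Theta>.P.indep_var_restrict by fastforce
    have sets: "?X \<in> sets (?E W)" "?Y \<in> sets (?E W')"
      by (intro sets_induced; use W in simp)+
    have "{\<theta> \<in> space (?E {1..}). Q (?S W \<theta>) \<and> R (?S W' \<theta>)} =
        {\<theta> \<in> space (?E {1..}). Q (?S W \<theta>)} \<inter> {\<theta> \<in> space (?E {1..}). R (?S W' \<theta>)}"
      by blast
    also have "\<dots> = (\<lambda>\<theta>. (restrict \<theta> (fin_subsets W), restrict \<theta> (fin_subsets W'))) -`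
        (?X \<times> ?Y) \<inter> space (?E {1..})"
      unfolding split[OF W(2), of Q] split[OF W(4), of R] by blast
    finally show "measure (?E {1..}) {\<theta> \<in> space (?E {1..}). Q (?S W \<theta>) \<and> R (?S W' \<theta>)} =
        measure (?E {1..}) {\<theta> \<in> space (?E {1..}). Q (?S W \<theta>)} *
        measure (?E {1..}) {\<theta> \<in> space (?E {1..}). R (?S W' \<theta>)}"
      unfolding split[OF W(2), of Q] split[OF W(4), of R]
      using \<Theta>.P.indep_varD[OF indep sets] by simp
  next
    show "{\<theta> \<in> space (?E {1..}). Q (?S W \<theta>)} \<in> sets (?E {1..})" if "finite W" "W \<subseteq> {1..}" for W Q
      using that by (intro sets_induced)
  qed (use model finite_symbols in auto)
qed

definition limit :: "'p struct set \<Rightarrow> real" where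
  "limit = array_limit (PiM (fin_subsets {1..}) (\<lambda>_. \<Omega>)) T (exch_array T \<N>)"

lemma limit_in_Hom_plus: "limit \<in> Hom_plus T"
  unfolding limit_def by (rule array.array_limit_in_Hom_plus)

lemma theon_limit_limit: "theon_limit \<Omega> T \<N> limit"
  unfolding theon_limit_def limit_def
proof
  fix M assume M: "M \<in> fin_models T"
  then show "array_limit (PiM (fin_subsets {1..}) (\<lambda>_. \<Omega>)) T (exch_array T \<N>) (iso_class T M) =
      \<P>(\<theta> in coord_space \<Omega> {1..}. iso T (induced T (exch_array T \<N> \<theta>) {1..card (verts M)}) M)"
    \<comment> \<open>The event is measurable before completion, so completing the measure leaves
      its probability unchanged.\<close>
    using array.copy_event_measurable[of "{1..card (verts M)}" M]
    unfolding array.array_limit_iso_class[OF M] array.copy_prob_def array.copy_event_def coord_space_def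
      space_completion
    by (intro measure_completion[symmetric]) auto
qed

lemma theon: "base_space \<Omega> \<Longrightarrow> theon \<Omega> T \<N>"
  unfolding theon_def coord_space_def using peon_measurable model
  by (auto intro!: AE_I2)

end

section \<open>The unit interval as a base space\<close>

text \<open>For atomlessness, a set of positive measure is cut into pieces lying in intervals
  shorter than that measure. Countably many null pieces could not cover it, so some piece has
  positive, yet strictly smaller, measure.\<close>

lemma base_space_unit_interval: "base_space (lebesgue_on {0..1::real})"
  unfolding base_space_def
proof (intro conjI)
  let ?\<mu> = "lebesgue_on {0..1::real}"
  have [simp]: "{0..1} \<inter> space lebesgue \<in> sets (lebesgue :: real measure)"
    by simp
  show "prob_space ?\<mu>"
    by (rule prob_spaceI) (simp add: emeasure_restrict_space)
  interpret prob_space ?\<mu> by fact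
  show "complete_measure ?\<mu>"
  proof
    fix A B :: "real set" assume "B \<subseteq> A" "A \<in> null_sets ?\<mu>"
    then show "B \<in> sets ?\<mu>"
      using completion.complete[of B A lborel]
      by (auto simp: null_sets_restrict_space sets_restrict_space_iff)
  qed
  show "atomless ?\<mu>"
    unfolding atomless_def
  proof (intro ballI impI)
    fix A assume A: "A \<in> sets ?\<mu>" "0 < emeasure ?\<mu> A"
    then have "0 < measure ?\<mu> A"
      by (simp add: emeasure_eq_measure)
    then obtain n where n: "inverse (real (Suc n)) < measure ?\<mu> A"
      using reals_Archimedean by blast
    \<comment> \<open>The pieces may share endpoints; only covering \<open>A\<close> and having
      measure at most 1/(n + 1) matters.\<close>
    define C where "C i = A \<inter> {real i / Suc n .. (real i + 1) / Suc n}" for i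
    have C: "C i \<in> sets ?\<mu>" for i
      using A(1) by (auto simp: C_def sets_restrict_space_iff)
    have "A \<subseteq> (\<Union>i. C i)"
    proof
      fix x assume x: "x \<in> A"
      then have "0 \<le> x"
        using A(1) by (auto simp: sets_restrict_space_iff)
      define i where "i = nat \<lfloor>x * Suc n\<rfloor>"
      have "real i = of_int \<lfloor>x * Suc n\<rfloor>"
        using \<open>0 \<le> x\<close> by (simp add: i_def)
      then have "real i \<le> x * Suc n" "x * Suc n \<le> real i + 1"
        by linarith+
      then have "x \<in> C i"
        using x by (simp add: C_def divide_le_eq le_divide_eq del: of_nat_Suc)
      then show "x \<in> (\<Union>i. C i)" by blast
    qed
    have "\<exists>i. C i \<notin> null_sets ?\<mu>"
    proof (rule ccontr)
      assume "\<nexists>i. C i \<notin> null_sets ?\<mu>"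
      then have "(\<Union>i. C i) \<in> null_sets ?\<mu>"
        by (intro null_sets_UN) auto
      with \<open>A \<subseteq> _\<close> A show False
        using null_sets_subset[of "\<Union>i. C i" ?\<mu> A] by auto
    qed
    then obtain i where i: "C i \<notin> null_sets ?\<mu>" ..
    have "emeasure ?\<mu> (C i) = emeasure lebesgue (C i)"
      using C[of i] by (intro emeasure_restrict_space) (auto simp: sets_restrict_space_iff)
    also have "\<dots> \<le> emeasure lebesgue {real i / Suc n .. (real i + 1) / Suc n}"
      by (intro emeasure_mono) (auto simp: C_def)
    also have "\<dots> = ennreal (inverse (Suc n))"
      by (simp add: divide_right_mono diff_divide_distrib[symmetric] inverse_eq_divide del: of_nat_Suc)
    also have "\<dots> < emeasure ?\<mu> A"
      using n by (simp add: emeasure_eq_measure ennreal_less_iff)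
    finally have "emeasure ?\<mu> (C i) < emeasure ?\<mu> A" .
    moreover have "0 < emeasure ?\<mu> (C i)"
      using i C[of i] by (auto simp: null_sets_def zero_less_iff_neq_zero)
    moreover have "C i \<subseteq> A"
      by (auto simp: C_def)
    ultimately show "\<exists>B\<in>sets ?\<mu>. B \<subseteq> A \<and> 0 < emeasure ?\<mu> B \<and> emeasure ?\<mu> B < emeasure ?\<mu> A"
      using C by blast
  qed
qed


section \<open>Models of the canonical theories\<close>

lemma theory_components [simp]:
  "symbols (hypergraph_theory k) = {()}" "arity (hypergraph_theory k) p = k"
  "symbols (pure_theory L ar) = L" "arity (pure_theory L ar) = ar"
  "symbols (union_theory T T') = symbols T <+> symbols T'"
  "arity (union_theory T T') = case_sum (arity T) (arity T')"
  by (simp_all add: hypergraph_theory_def pure_theory_def union_theory_def)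

lemma holds_canonical_axs:
  assumes "f \<in> canonical_axs L ar"
    and "\<And>P \<alpha>. P \<in> L \<Longrightarrow> \<alpha> \<in> rel M P \<Longrightarrow> inj_on \<alpha> {1..ar P}"
    and "\<And>P. P \<in> L \<Longrightarrow> arity T P = ar P"
  shows "holds T M v f"
proof -
  obtain P i j where f: "f = Imp (Eq i j) (Neg (Atom P id))"
    and P: "P \<in> L" "1 \<le> i" "i < j" "j \<le> ar P"
    using assms(1) unfolding canonical_axs_def by blast
  have "v i \<noteq> v j" if "(\<lambda>i\<in>{1..ar P}. v i) \<in> rel M P"
  proof -
    have "inj_on v {1..ar P}"
      using assms(2)[OF P(1) that] by simp
    then show ?thesis
      using inj_onD[of v "{1..ar P}" i j] P by auto
  qed
  then show ?thesis
    using assms(3)[OF P(1)] by (auto simp: f)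
qed

lemma inj_on_exch_array: "\<alpha> \<in> rel (exch_array T \<N> \<theta>) P \<Longrightarrow> inj_on \<alpha> {1..arity T P}"
  by (auto simp: exch_array_def split: if_splits)

lemma is_model_pure_theory:
  assumes "is_struct (pure_theory L ar) M"
    and "\<And>P \<alpha>. P \<in> L \<Longrightarrow> \<alpha> \<in> rel M P \<Longrightarrow> inj_on \<alpha> {1..ar P}"
  shows "is_model (pure_theory L ar) M"
proof -
  have "holds (pure_theory L ar) M v f" if "f \<in> canonical_axs L ar" for f v
    using that assms(2) by (rule holds_canonical_axs) auto
  with assms(1) show ?thesis
    by (simp add: is_model_def pure_theory_def)
qed

text \<open>The symmetry axioms are replaced by invariance under tuples with the same set of
  entries. A permutation of the positions keeps that set, and clique conditions are visibly
  invariant in this sense.\<close>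

lemma is_model_hypergraph_theory:
  assumes "is_struct (hypergraph_theory k) M"
    and "\<And>\<alpha>. \<alpha> \<in> rel M () \<Longrightarrow> inj_on \<alpha> {1..k}"
    and sym: "\<And>\<alpha> \<beta>. \<alpha> \<in> rel M () \<Longrightarrow> \<beta> \<in> {1..k} \<rightarrow>\<^sub>E verts M \<Longrightarrow> inj_on \<beta> {1..k} \<Longrightarrow>
      \<beta> ` {1..k} = \<alpha> ` {1..k} \<Longrightarrow> \<beta> \<in> rel M ()"
  shows "is_model (hypergraph_theory k) M"
  unfolding is_model_def
proof (intro conjI ballI allI impI)
  fix f and v :: "nat \<Rightarrow> nat" assume f: "f \<in> axs (hypergraph_theory k)" and v: "range v \<subseteq> verts M"
  show "holds (hypergraph_theory k) M v f"
  proof (cases "f \<in> canonical_axs {()} (\<lambda>_. k)")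
    case True
    then show ?thesis
      using assms(2) by (rule holds_canonical_axs) auto
  next
    case False
    then obtain s where s: "s permutes {1..k}" and f: "f = Imp (Atom () id) (Atom () s)"
      using f by (auto simp: hypergraph_theory_def)
    have "(\<lambda>i\<in>{1..k}. v (s i)) \<in> rel M ()" if v_rel: "(\<lambda>i\<in>{1..k}. v i) \<in> rel M ()"
    proof (rule sym[OF v_rel])
      have inj: "inj_on v {1..k}"
        using assms(2)[OF v_rel] by simp
      then have "inj_on (v \<circ> s) {1..k}"
        using s by (simp add: comp_inj_on permutes_image permutes_inj_on)
      then show "inj_on (\<lambda>i\<in>{1..k}. v (s i)) {1..k}"
        by (simp add: comp_def)
      show "(\<lambda>i\<in>{1..k}. v (s i)) ` {1..k} = (\<lambda>i\<in>{1..k}. v i) ` {1..k}"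
        using permutes_image[OF s] image_image[of v s "{1..k}"] by simp
    qed (use v in auto)
    then show ?thesis
      by (simp add: f hypergraph_theory_def)
  qed
qed fact

lemma holds_map_qf:
  assumes "\<And>p. arity U (c p) = arity T p"
  shows "holds U M v (map_qf c f) \<longleftrightarrow> holds T (reduct c M) v f"
  using assms by (induction f) (simp_all add: reduct_def)

lemma is_model_union_theory:
  assumes "is_struct (union_theory T T') M" "is_model T (reduct Inl M)" "is_model T' (reduct Inr M)"
  shows "is_model (union_theory T T') M"
proof -
  have "holds (union_theory T T') M v (map_qf Inl f) \<longleftrightarrow> holds T (reduct Inl M) v f"
    "holds (union_theory T T') M v (map_qf Inr g) \<longleftrightarrow> holds T' (reduct Inr M) v g" for v f g
    by (rule holds_map_qf, simp)+
  then show ?thesis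
    using assms by (auto simp: is_model_def reduct_def union_theory_def)
qed

lemma reduct_exch_array_union:
  "reduct Inl (exch_array (union_theory T T') \<N> \<theta>) = exch_array T (\<lambda>p. \<N> (Inl p)) \<theta>"
  "reduct Inr (exch_array (union_theory T T') \<N> \<theta>) = exch_array T' (\<lambda>p. \<N> (Inr p)) \<theta>"
  by (simp_all add: reduct_def exch_array_def Plus_def image_iff cong: if_cong)


section \<open>Cliques of a random uniform hypergraph\<close>

text \<open>
  The coordinates indexed by \<open>s\<close>-sets that fall into \<open>B\<close> form a random \<open>s\<close>-uniform hypergraph;
  an \<open>m\<close>-tuple lies in the peon if its entries span a clique there.
\<close>

definition clique_peon :: "'x measure \<Rightarrow> 'x set \<Rightarrow> nat \<Rightarrow> nat \<Rightarrow> (nat set \<Rightarrow> 'x) set" where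
  "clique_peon \<Omega> B s m = {x \<in> space (PiM (fin_subsets {1..m}) (\<lambda>_. \<Omega>)).
     \<forall>A\<in>fin_subsets {1..m}. card A = s \<longrightarrow> x A \<in> B}"

abbreviation clique_theon :: "'x measure \<Rightarrow> 'x set \<Rightarrow> nat \<Rightarrow> 'p utheory \<Rightarrow> 'p \<Rightarrow> (nat set \<Rightarrow> 'x) set" where
  "clique_theon \<Omega> B s T \<equiv> \<lambda>P. clique_peon \<Omega> B s (arity T P)"

lemma sets_clique_peon:
  assumes "B \<in> sets \<Omega>"
  shows "clique_peon \<Omega> B s m \<in> sets (PiM (fin_subsets {1..m}) (\<lambda>_. \<Omega>))"
proof -
  have "finite (fin_subsets {1..m})"
    by (rule finite_subset[of _ "Pow {1..m}"]) (auto simp: fin_subsets_def)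
  then show ?thesis
    unfolding clique_peon_def imp_conv_disj using assms
    by (intro sets.sets_Collect_finite_All sets.sets_Collect_disj sets.sets_Collect_const
        sets_Collect_single') auto
qed

lemma peon_independent_clique_peon:
  assumes "l < s"
  shows "peon_independent \<Omega> m l (clique_peon \<Omega> B s m)"
  unfolding peon_independent_def
proof (intro exI conjI)
  let ?J = "{A \<in> fin_subsets {1..m}. l < card A}"
  let ?H = "{y \<in> ?J \<rightarrow>\<^sub>E space \<Omega>. \<forall>A\<in>?J. card A = s \<longrightarrow> y A \<in> B}"
  show "?H \<subseteq> ?J \<rightarrow>\<^sub>E space \<Omega>"
    by blast
  have "restrict x ?J \<in> ?H \<longleftrightarrow> (\<forall>A\<in>fin_subsets {1..m}. card A = s \<longrightarrow> x A \<in> B)"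
    if "x \<in> fin_subsets {1..m} \<rightarrow>\<^sub>E space \<Omega>" for x
    using that assms by (auto simp: PiE_iff)
  then show "clique_peon \<Omega> B s m = {x \<in> fin_subsets {1..m} \<rightarrow>\<^sub>E space \<Omega>. restrict x ?J \<in> ?H}"
    unfolding clique_peon_def space_PiM by blast
qed

text \<open>An injective \<alpha> maps the s-subsets of its domain exactly onto the s-subsets of its
  image, so the peon condition becomes a statement about the image alone. The symmetry of the
  hypergraph and all probabilities below are read off from this form.\<close>

lemma rel_exch_array_clique:
  assumes \<theta>: "\<theta> \<in> space (PiM (fin_subsets {1..}) (\<lambda>_. \<Omega>))" and s: "0 < s"
  shows "\<alpha> \<in> rel (exch_array T (clique_theon \<Omega> B s T) \<theta>) P \<longleftrightarrow>
    P \<in> symbols T \<and> \<alpha> \<in> {1..arity T P} \<rightarrow>\<^sub>E {1..} \<and> inj_on \<alpha> {1..arity T P} \<and>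
    (\<forall>A. A \<subseteq> \<alpha> ` {1..arity T P} \<and> card A = s \<longrightarrow> \<theta> A \<in> B)"
proof -
  let ?m = "arity T P"
  have "pullback ?m \<alpha> \<theta> \<in> clique_peon \<Omega> B s ?m \<longleftrightarrow>
      (\<forall>A. A \<subseteq> \<alpha> ` {1..?m} \<and> card A = s \<longrightarrow> \<theta> A \<in> B)"
    if \<alpha>: "\<alpha> \<in> {1..?m} \<rightarrow>\<^sub>E {1..}" and inj: "inj_on \<alpha> {1..?m}"
  proof -
    have "\<alpha> ` A \<in> fin_subsets {1..}" if "A \<in> fin_subsets {1..?m}" for A
      using that \<alpha> by (intro image_in_fin_subsets) auto
    then have "pullback ?m \<alpha> \<theta> \<in> space (PiM (fin_subsets {1..?m}) (\<lambda>_. \<Omega>))"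
      using \<theta> by (auto simp: pullback_def space_PiM PiE_iff)
    then have "pullback ?m \<alpha> \<theta> \<in> clique_peon \<Omega> B s ?m \<longleftrightarrow>
        (\<forall>A\<in>fin_subsets {1..?m}. card A = s \<longrightarrow> \<theta> (\<alpha> ` A) \<in> B)"
      by (simp add: clique_peon_def pullback_def)
    also have "\<dots> \<longleftrightarrow> (\<forall>A. A \<subseteq> {1..?m} \<longrightarrow> card (\<alpha> ` A) = s \<longrightarrow> \<theta> (\<alpha> ` A) \<in> B)"
    proof -
      have "card (\<alpha> ` A) = card A" if "A \<subseteq> {1..?m}" for A
        using inj_on_subset[OF inj that] by (rule card_image)
      \<comment> \<open>Positivity of \<open>s\<close> excludes the empty set, which indexes no
        coordinate.\<close>
      moreover have "A \<in> fin_subsets {1..?m}" if "A \<subseteq> {1..?m}" "card A = s" for A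
        using that s by (auto simp: fin_subsets_def dest: finite_subset)
      moreover have "A \<subseteq> {1..?m}" if "A \<in> fin_subsets {1..?m}" for A
        using that by (simp add: fin_subsets_def)
      ultimately show ?thesis
        by metis
    qed
    also have "\<dots> \<longleftrightarrow> (\<forall>A. A \<subseteq> \<alpha> ` {1..?m} \<and> card A = s \<longrightarrow> \<theta> A \<in> B)"
      by (metis subset_image_iff)
    finally show ?thesis .
  qed
  then show ?thesis
    unfolding exch_array_def by auto
qed

lemma borel_theon_clique:
  assumes "prob_space \<Omega>" "finite (symbols T)" "B \<in> sets \<Omega>"
    and "\<And>\<theta>. \<theta> \<in> space (PiM (fin_subsets {1..}) (\<lambda>_. \<Omega>)) \<Longrightarrow>
      is_model T (exch_array T (clique_theon \<Omega> B s T) \<theta>)"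
  shows "borel_theon \<Omega> T (clique_theon \<Omega> B s T)"
  using assms by (intro borel_theon.intro borel_theon_axioms.intro sets_clique_peon)

lemma is_model_hypergraph_clique:
  assumes "\<theta> \<in> space (PiM (fin_subsets {1..}) (\<lambda>_. \<Omega>))" "0 < s"
  shows "is_model (hypergraph_theory k)
    (exch_array (hypergraph_theory k) (clique_theon \<Omega> B s (hypergraph_theory k)) \<theta>)"
proof (rule is_model_hypergraph_theory)
  note rel = rel_exch_array_clique[OF assms, where T = "hypergraph_theory k"]
  show "\<beta> \<in> rel (exch_array (hypergraph_theory k) (clique_theon \<Omega> B s (hypergraph_theory k)) \<theta>) ()"
    if "\<alpha> \<in> rel (exch_array (hypergraph_theory k) (clique_theon \<Omega> B s (hypergraph_theory k)) \<theta>) ()"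
      "\<beta> \<in> {1..k} \<rightarrow>\<^sub>E verts (exch_array (hypergraph_theory k) (clique_theon \<Omega> B s (hypergraph_theory k)) \<theta>)"
      "inj_on \<beta> {1..k}" "\<beta> ` {1..k} = \<alpha> ` {1..k}" for \<alpha> \<beta>
    using that unfolding rel verts_exch_array by (simp only: theory_components simp_thms) blast
  show "inj_on \<alpha> {1..k}"
    if "\<alpha> \<in> rel (exch_array (hypergraph_theory k) (clique_theon \<Omega> B s (hypergraph_theory k)) \<theta>) ()" for \<alpha>
    using inj_on_exch_array[OF that] by simp
qed (rule is_struct_exch_array)

section \<open>The single edge and the probability of a clique\<close>

lemma edge_graph_in_fin_models: "edge_graph k \<in> fin_models (hypergraph_theory k)"
  unfolding fin_models_def
  by (auto intro!: is_model_hypergraph_theory simp: edge_graph_def is_struct_def)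

lemma measure_clique_event:
  assumes "prob_space \<Omega>" "B \<in> sets \<Omega>" "0 < s" "V \<subseteq> {1..}" "finite V"
  defines "X \<equiv> {\<theta> \<in> space (PiM (fin_subsets {1..}) (\<lambda>_. \<Omega>)). \<forall>A. A \<subseteq> V \<and> card A = s \<longrightarrow> \<theta> A \<in> B}"
  shows "X \<in> sets (PiM (fin_subsets {1..}) (\<lambda>_. \<Omega>))"
    "measure (PiM (fin_subsets {1..}) (\<lambda>_. \<Omega>)) X = measure \<Omega> B ^ (card V choose s)"
proof -
  interpret product_prob_space "\<lambda>_. \<Omega>" "fin_subsets {1..}"
    using assms(1) by (intro product_prob_spaceI)
  define J where "J = {A. A \<subseteq> V \<and> card A = s}"
  have J: "finite J" "J \<subseteq> fin_subsets {1..}"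
    using assms(3-5) unfolding J_def fin_subsets_def by (auto dest: finite_subset)
  have X: "X = {\<theta> \<in> space (PiM (fin_subsets {1..}) (\<lambda>_. \<Omega>)). \<forall>A\<in>J. \<theta> A \<in> B}"
    by (auto simp: X_def J_def)
  show "X \<in> sets (PiM (fin_subsets {1..}) (\<lambda>_. \<Omega>))"
    unfolding X using J assms(2)
    by (intro sets.sets_Collect_finite_All sets_Collect_single') auto
  have "emeasure (PiM (fin_subsets {1..}) (\<lambda>_. \<Omega>)) X = (\<Prod>A\<in>J. emeasure \<Omega> B)"
    unfolding X using J assms(2) by (intro emeasure_PiM_Collect) auto
  also have "\<dots> = ennreal (measure \<Omega> B ^ card J)"
    by (simp add: M.emeasure_eq_measure ennreal_power)
  also have "card J = card V choose s"
    unfolding J_def using assms(5) by (rule n_subsets)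
  finally show "measure (PiM (fin_subsets {1..}) (\<lambda>_. \<Omega>)) X = measure \<Omega> B ^ (card V choose s)"
    by (simp add: measure_def)
qed

text \<open>An isomorphism carries the identity tuple to an injective tuple, which is an edge of the
  complete structure, so the identity tuple is an edge of the sample. Conversely, a clique makes
  every injective tuple an edge, and the sample is then literally equal to
  \<open>edge_graph k\<close>.\<close>

lemma iso_edge_graph_clique:
  fixes k :: nat
  assumes \<theta>: "\<theta> \<in> space (PiM (fin_subsets {1..}) (\<lambda>_. \<Omega>))" and s: "0 < s"
  defines "T \<equiv> hypergraph_theory k"
  shows "iso T (induced T (exch_array T (clique_theon \<Omega> B s T) \<theta>) {1..k}) (edge_graph k) \<longleftrightarrow>
    (\<forall>A. A \<subseteq> {1..k} \<and> card A = s \<longrightarrow> \<theta> A \<in> B)"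
proof
  let ?S = "induced T (exch_array T (clique_theon \<Omega> B s T) \<theta>) {1..k}"
  note rel = rel_exch_array_clique[OF \<theta> s, where T = T and P = "()"]
  assume "iso T ?S (edge_graph k)"
  then obtain f where f: "bij_betw f {1..k} {1..k}"
    and r: "\<And>\<alpha>. \<alpha> \<in> {1..k} \<rightarrow>\<^sub>E {1..k} \<Longrightarrow> \<alpha> \<in> rel ?S () \<longleftrightarrow> (\<lambda>i\<in>{1..k}. f (\<alpha> i)) \<in> rel (edge_graph k) ()"
    by (auto simp: iso_def T_def edge_graph_def)
  have "restrict f {1..k} \<in> rel (edge_graph k) ()"
    using bij_betw_imp_funcset[OF f] bij_betw_imp_inj_on[OF f]
    by (simp add: edge_graph_def restrict_PiE_iff Pi_iff)
  moreover have "(\<lambda>i\<in>{1..k}. f ((\<lambda>i\<in>{1..k}. i) i)) = restrict f {1..k}"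
    by (simp cong: restrict_cong)
  moreover have "(\<lambda>i\<in>{1..k}. i) \<in> {1..k} \<rightarrow>\<^sub>E {1..k}"
    by simp
  ultimately have "(\<lambda>i\<in>{1..k}. i) \<in> rel ?S ()"
    using r by metis
  then have "(\<lambda>i\<in>{1..k}. i) \<in> rel (exch_array T (clique_theon \<Omega> B s T) \<theta>) ()"
    by (simp add: induced_def)
  then show "\<forall>A. A \<subseteq> {1..k} \<and> card A = s \<longrightarrow> \<theta> A \<in> B"
    unfolding rel by (simp add: T_def)
next
  let ?S = "induced T (exch_array T (clique_theon \<Omega> B s T) \<theta>) {1..k}"
  assume *: "\<forall>A. A \<subseteq> {1..k} \<and> card A = s \<longrightarrow> \<theta> A \<in> B"
  have "\<alpha> \<in> rel ?S () \<longleftrightarrow> \<alpha> \<in> {1..k} \<rightarrow>\<^sub>E {1..k} \<and> inj_on \<alpha> {1..k}" for \<alpha>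
  proof -
    have "\<alpha> \<in> rel ?S () \<longleftrightarrow> (\<alpha> \<in> {1..k} \<rightarrow>\<^sub>E {1..} \<and> \<alpha> ` {1..k} \<subseteq> {1..k}) \<and> inj_on \<alpha> {1..k} \<and>
        (\<forall>A. A \<subseteq> \<alpha> ` {1..k} \<and> card A = s \<longrightarrow> \<theta> A \<in> B)"
      using rel_exch_array_clique[OF \<theta> s, of \<alpha> T B "()"]
      unfolding induced_def T_def theory_components by auto
    also have "\<dots> \<longleftrightarrow> (\<alpha> \<in> {1..k} \<rightarrow>\<^sub>E {1..} \<and> \<alpha> ` {1..k} \<subseteq> {1..k}) \<and> inj_on \<alpha> {1..k}"
      using * subset_trans by metis
    also have "\<alpha> \<in> {1..k} \<rightarrow>\<^sub>E {1..} \<and> \<alpha> ` {1..k} \<subseteq> {1..k} \<longleftrightarrow> \<alpha> \<in> {1..k} \<rightarrow>\<^sub>E {1..k}"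
      by (auto simp: PiE_iff)
    finally show ?thesis .
  qed
  then have "?S = edge_graph k"
    by (intro struct.equality) (auto simp: edge_graph_def fun_eq_iff)
  then show "iso T ?S (edge_graph k)"
    by (simp add: iso_refl)
qed

lemma incr_enum_interval: "incr_enum {1..n} = (\<lambda>i\<in>{1..n}. i)"
  by (auto simp: incr_enum_def fun_eq_iff restrict_def nth_upt simp flip: atLeastLessThanSuc_atLeastAtMost simp del: upt_Suc)

section \<open>The coupling with the random hypergraph and the failure of Disc\<close>

theorem theorem3p16:
  fixes k l :: nat
  assumes "1 \<le> l" and "l < k"
  shows "\<exists>\<phi> \<in> Hom_plus (hypergraph_theory k).
           independence (hypergraph_theory k) l \<phi> \<and> \<not> disc k {{1..l + 1}} \<phi>"
proof -
  define \<Omega> where "\<Omega> = lebesgue_on {0..1::real}"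
  \<comment> \<open>Any set of measure p strictly between 0 and 1 would do: Disc would force p^N =
    p^N * p, where N is k choose (l + 1).\<close>
  define B where "B = {0..1/2::real}"
  define s where "s = l + 1"
  define E where "E = PiM (fin_subsets {1..}) (\<lambda>_. \<Omega>)"
  define T where "T = hypergraph_theory k"
  define T' where "T' = pure_theory {{1..s}} (card :: nat set \<Rightarrow> nat)"
  define U where "U = union_theory T T'"
  have base: "base_space \<Omega>"
    unfolding \<Omega>_def by (rule base_space_unit_interval)
  then interpret \<Omega>: prob_space \<Omega>
    by (simp add: base_space_def)
  have B: "B \<in> sets \<Omega>" "measure \<Omega> B = 1/2"
    by (auto simp: B_def \<Omega>_def sets_restrict_space_iff measure_restrict_space)
  have s: "0 < s" "s \<le> k"
    using assms by (auto simp: s_def)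
  interpret T: borel_theon \<Omega> T "clique_theon \<Omega> B s T"
    using is_model_hypergraph_clique[OF _ s(1)] unfolding T_def
    by (intro borel_theon_clique \<Omega>.prob_space_axioms B(1)) auto
  interpret T': borel_theon \<Omega> T' "clique_theon \<Omega> B s T'"
  proof (intro borel_theon_clique \<Omega>.prob_space_axioms B(1))
    show "is_model T' (exch_array T' (clique_theon \<Omega> B s T') \<theta>)" for \<theta>
      unfolding T'_def using inj_on_exch_array[of _ "pure_theory {{1..s}} card"]
      by (intro is_model_pure_theory is_struct_exch_array) (simp only: theory_components)
  qed (simp add: T'_def)
  \<comment> \<open>The arities in \<open>U\<close> are those of the two parts, so the clique theon
    of \<open>U\<close> restricts to the clique theons of \<open>T\<close> and \<open>T'\<close> on
    the same \<theta>. This shared source of randomness is the coupling.\<close>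
  have reduct: "reduct Inl (exch_array U (clique_theon \<Omega> B s U) \<theta>) = exch_array T (clique_theon \<Omega> B s T) \<theta>"
    "reduct Inr (exch_array U (clique_theon \<Omega> B s U) \<theta>) = exch_array T' (clique_theon \<Omega> B s T') \<theta>" for \<theta>
    by (simp_all add: U_def reduct_exch_array_union)
  interpret U: borel_theon \<Omega> U "clique_theon \<Omega> B s U"
  proof (intro borel_theon_clique \<Omega>.prob_space_axioms B(1))
    show "is_model U (exch_array U (clique_theon \<Omega> B s U) \<theta>)"
      if "\<theta> \<in> space (PiM (fin_subsets {1..}) (\<lambda>_. \<Omega>))" for \<theta>
      using T.model[OF that] T'.model[OF that] is_struct_exch_array
      unfolding reduct[symmetric] by (auto simp: U_def intro: is_model_union_theory)
  qed (simp add: U_def T_def T'_def)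
  have U_symbols: "Inl ` symbols T \<subseteq> symbols U" "Inr ` symbols T' \<subseteq> symbols U"
    and U_arity: "arity U (Inl p) = arity T p" "arity U (Inr q) = arity T' q" for p q
    by (auto simp: U_def)
  have "limit_reduct Inl T U U.limit = T.limit"
    unfolding T.limit_def U.limit_def
    using T.array.dissociated_array_axioms U.array.dissociated_array_axioms U_symbols(1) U_arity(1) reduct(1)
    by (rule limit_reduct_array_limit)
  moreover have "limit_reduct Inr T' U U.limit = T'.limit"
    unfolding T'.limit_def U.limit_def
    using T'.array.dissociated_array_axioms U.array.dissociated_array_axioms U_symbols(2) U_arity(2) reduct(2)
    by (rule limit_reduct_array_limit)
  ultimately have "coupling T T' T.limit T'.limit U.limit"
    unfolding coupling_def U_def[symmetric] using U.limit_in_Hom_plus by blast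
  define clique where "clique n = {\<theta> \<in> space E. \<forall>A. A \<subseteq> {1..n} \<and> card A = s \<longrightarrow> \<theta> A \<in> B}" for n :: nat
  have clique: "clique n \<in> sets E" "measure E (clique n) = (1/2) ^ (n choose s)" for n
    using measure_clique_event[OF \<Omega>.prob_space_axioms B(1) s(1), of "{1..n}"] B(2)
    by (auto simp: clique_def E_def)
  \<comment> \<open>Every probability in \<open>disc\<close> is that of a clique event, with n = k
    or n = s. These events are measurable before completion, where their measure is known.\<close>
  have completion: "\<P>(\<theta> in coord_space \<Omega> {1..}. Q \<theta>) = measure E (clique n)"
    if "\<And>\<theta>. \<theta> \<in> space E \<Longrightarrow> Q \<theta> \<longleftrightarrow> (\<forall>A. A \<subseteq> {1..n} \<and> card A = s \<longrightarrow> \<theta> A \<in> B)" for Q n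
  proof -
    have "{\<theta> \<in> space E. Q \<theta>} = clique n"
      using that by (auto simp: clique_def)
    then show ?thesis
      using clique(1)[of n] unfolding coord_space_def E_def[symmetric] by simp
  qed
  have rel: "(\<lambda>i\<in>{1..arity U P}. i) \<in> rel (exch_array U (clique_theon \<Omega> B s U) \<theta>) P \<longleftrightarrow>
      (\<forall>A. A \<subseteq> {1..arity U P} \<and> card A = s \<longrightarrow> \<theta> A \<in> B)"
    if "\<theta> \<in> space E" "P \<in> symbols U" for \<theta> P
    using rel_exch_array_clique[OF that(1)[unfolded E_def] s(1), of "\<lambda>i\<in>{1..arity U P}. i" U B P] that(2)
    by simp
  have in_U: "Inl () \<in> symbols U" "Inr {1..s} \<in> symbols U"
    and arity_U: "arity U (Inl ()) = k" "arity U (Inr {1..s}) = s"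
    by (auto simp: U_def T_def T'_def)
  have edge: "(\<lambda>i\<in>{1..k}. i) \<in> rel (exch_array U (clique_theon \<Omega> B s U) \<theta>) (Inl ()) \<longleftrightarrow>
      (\<forall>A. A \<subseteq> {1..k} \<and> card A = s \<longrightarrow> \<theta> A \<in> B)" if "\<theta> \<in> space E" for \<theta>
    using rel[OF that in_U(1)] unfolding arity_U .
  have base_edge: "(\<forall>A\<in>{{1..s}}. incr_enum A \<in> rel (exch_array U (clique_theon \<Omega> B s U) \<theta>) (Inr A)) \<longleftrightarrow>
      (\<forall>A. A \<subseteq> {1..s} \<and> card A = s \<longrightarrow> \<theta> A \<in> B)" if "\<theta> \<in> space E" for \<theta>
    using rel[OF that in_U(2)] unfolding arity_U incr_enum_interval[symmetric] by simp
  have "T.limit (iso_class T (edge_graph k)) = \<P>(\<theta> in coord_space \<Omega> {1..}.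
      iso T (induced T (exch_array T (clique_theon \<Omega> B s T) \<theta>) {1..card (verts (edge_graph k))}) (edge_graph k))"
    using T.theon_limit_limit edge_graph_in_fin_models unfolding theon_limit_def T_def by blast
  also have "\<dots> = measure E (clique k)"
    using iso_edge_graph_clique[OF _ s(1), of _ \<Omega> k B]
    by (intro completion) (simp add: E_def T_def edge_graph_def)
  finally have edge_density: "T.limit (iso_class T (edge_graph k)) = (1/2) ^ (k choose s)"
    by (simp add: clique)
  have "independence T l T.limit"
    unfolding independence_def
    by (intro exI[of _ \<Omega>] exI[of _ "clique_theon \<Omega> B s T"] conjI ballI T.theon[OF base]
        T.theon_limit_limit peon_independent_clique_peon) (simp add: s_def)
  moreover have "\<not> disc k {{1..s}} T.limit"
  proof
    assume "disc k {{1..s}} T.limit"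
    then have "\<P>(\<theta> in coord_space \<Omega> {1..}.
          (\<lambda>i\<in>{1..k}. i) \<in> rel (exch_array U (clique_theon \<Omega> B s U) \<theta>) (Inl ()) \<and>
          (\<forall>A\<in>{{1..s}}. incr_enum A \<in> rel (exch_array U (clique_theon \<Omega> B s U) \<theta>) (Inr A))) =
        T.limit (iso_class T (edge_graph k)) * \<P>(\<theta> in coord_space \<Omega> {1..}.
          \<forall>A\<in>{{1..s}}. incr_enum A \<in> rel (exch_array U (clique_theon \<Omega> B s U) \<theta>) (Inr A))"
      using T'.limit_in_Hom_plus \<open>coupling _ _ _ _ _\<close> U.theon[OF base] U.theon_limit_limit
      unfolding disc_def Let_def T_def[symmetric] T'_def[symmetric] U_def[symmetric] by blast
    moreover have "\<P>(\<theta> in coord_space \<Omega> {1..}.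
          (\<lambda>i\<in>{1..k}. i) \<in> rel (exch_array U (clique_theon \<Omega> B s U) \<theta>) (Inl ()) \<and>
          (\<forall>A\<in>{{1..s}}. incr_enum A \<in> rel (exch_array U (clique_theon \<Omega> B s U) \<theta>) (Inr A))) =
        measure E (clique k)"
    \<comment> \<open>The s-subsets of \<open>{1..s}\<close> are among those of
      \<open>{1..k}\<close>, so the first conjunct implies the second and the conjunction is again
      the clique event for k.\<close>
    proof (rule completion)
      fix \<theta> assume \<theta>: "\<theta> \<in> space E"
      have "{1..s} \<subseteq> {1..k}"
        using s by auto
      then show "(\<lambda>i\<in>{1..k}. i) \<in> rel (exch_array U (clique_theon \<Omega> B s U) \<theta>) (Inl ()) \<and>
          (\<forall>A\<in>{{1..s}}. incr_enum A \<in> rel (exch_array U (clique_theon \<Omega> B s U) \<theta>) (Inr A)) \<longleftrightarrow>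
          (\<forall>A. A \<subseteq> {1..k} \<and> card A = s \<longrightarrow> \<theta> A \<in> B)"
        unfolding edge[OF \<theta>] base_edge[OF \<theta>] by blast
    qed
    moreover have "\<P>(\<theta> in coord_space \<Omega> {1..}.
          \<forall>A\<in>{{1..s}}. incr_enum A \<in> rel (exch_array U (clique_theon \<Omega> B s U) \<theta>) (Inr A)) =
        measure E (clique s)"
      by (rule completion) (rule base_edge)
    \<comment> \<open>The factor 1/2 is the measure of \<open>clique s\<close>, as
      \<open>{1..s}\<close> has itself as its only s-subset. The edge density is positive and
      cancels.\<close>
    ultimately have "(1/2::real) ^ (k choose s) = (1/2) ^ (k choose s) * (1/2)"
      unfolding edge_density by (simp only: clique binomial_n_n power_one_right)
    then show False
      by simp
  qed
  ultimately show ?thesis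
    using T.limit_in_Hom_plus unfolding T_def s_def by blast
qed

end
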